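(* Let $K \subset \mathbb{R}^d$ be a circumscribed convex body and let $O$ be the centre of its inscribed sphere. Let $Y_O$ have the projective distribution on $\partial K$ with centre of projection $O$, and let $Y$ be uniformly distributed on $\partial K$. Then $Y_O$ and $Y$ have the same distribution.
   Context: A convex body is a convex compact set with non-empty interior. "Uniform on $\partial K$" is with respect to $(d-1)$-dimensional surface measure. A convex body $K$ is circumscribed, with inscribed sphere of centre $O$ and radius $r>0$, if the closed ball $B(O,r)$ is contained in $K$ and for $\mathcal{H}^{d-1}$-almost every $x \in \partial K$ the supporting hyperplane of $K$ at $x$ is tangent to this ball, i.e. lies at distance $r$ from $O$ (for a convex polytope: the sphere touches every hyperplane spanned by a facet). Projective distribution with centre $O$: the distribution of the random boundary point obtained by taking a uniformly distributed (Lebesgue) random point $Z$ in $K$ and replacing $Z \ne O$ by the unique point where the ray from $O$ through $Z$ meets $\partial K$. *)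

theory Defs
  imports "HOL-Probability.Probability"
begin

section \<open>Hausdorff measure\<close>

text \<open>
  The weight \<open>unit_ball_vol n * (diameter U / 2) ^ n\<close> is the usual normalisation, for which
  the \<open>n\<close>-dimensional measure on an \<open>n\<close>-dimensional Euclidean space is Lebesgue measure. The
  case distinction gives the empty set weight \<open>0\<close> also for \<open>n = 0\<close>, where \<open>0 ^ 0 = 1\<close>
  makes every other set have weight \<open>1\<close>, so that \<open>n = 0\<close> yields counting measure.
\<close>

definition hausdorff_weight :: "nat \<Rightarrow> 'a::metric_space set \<Rightarrow> ennreal" where
  "hausdorff_weight n U =
     (if U = {} then 0 else ennreal (unit_ball_vol (real n) * (diameter U / 2) ^ n))"

text \<open>
  Boundedness has to be required of the covering sets because \<open>diameter\<close> is real-valued and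
  hence has no meaningful value on unbounded sets. The infimum over no cover at all is \<open>\<infinity>\<close>.
\<close>

definition hausdorff_pre :: "nat \<Rightarrow> real \<Rightarrow> 'a::metric_space set \<Rightarrow> ennreal" where
  "hausdorff_pre n \<delta> A =
     (INF U \<in> {U :: nat \<Rightarrow> 'a set. A \<subseteq> (\<Union>i. U i) \<and> (\<forall>i. bounded (U i) \<and> diameter (U i) \<le> \<delta>)}.
        \<Sum>i. hausdorff_weight n (U i))"

definition hausdorff_outer :: "nat \<Rightarrow> 'a::metric_space set \<Rightarrow> ennreal" where
  "hausdorff_outer n A = (SUP \<delta> \<in> {0<..}. hausdorff_pre n \<delta> A)"

definition hausdorff_measure :: "nat \<Rightarrow> 'a::metric_space measure" where
  "hausdorff_measure n = measure_of UNIV (sets borel) (hausdorff_outer n)"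

lemma space_hausdorff_measure [simp]: "space (hausdorff_measure n) = UNIV"
  by (simp add: hausdorff_measure_def space_measure_of_conv)

lemma sets_hausdorff_measure [simp, measurable_cong]: "sets (hausdorff_measure n) = sets borel"
  unfolding hausdorff_measure_def
  by (metis sets.sigma_sets_eq sets_measure_of space_borel subset_UNIV Pow_UNIV)

text \<open>
  \<open>measure_of\<close> is the zero measure unless its last argument is a measure on the given sets. The
  rest of this section shows that it is one, i.e. that Borel sets are Caratheodory measurable.
\<close>

lemma hausdorff_pre_le:
  assumes "A \<subseteq> (\<Union>i. U i)" "\<And>i. bounded (U i)" "\<And>i. diameter (U i) \<le> \<delta>"
  shows "hausdorff_pre n \<delta> A \<le> (\<Sum>i. hausdorff_weight n (U i))"
  unfolding hausdorff_pre_def using assms by (intro INF_lower) auto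

lemma hausdorff_weight_empty [simp]: "hausdorff_weight n {} = 0"
  by (simp add: hausdorff_weight_def)

lemma hausdorff_pre_empty: "\<delta> > 0 \<Longrightarrow> hausdorff_pre n \<delta> {} = 0"
  using hausdorff_pre_le[of "{}" "\<lambda>_. {}" \<delta> n] by simp

lemma hausdorff_pre_mono: "A \<subseteq> B \<Longrightarrow> hausdorff_pre n \<delta> A \<le> hausdorff_pre n \<delta> B"
  unfolding hausdorff_pre_def by (intro INF_superset_mono) auto

lemma hausdorff_pre_antimono: "\<delta> \<le> \<epsilon> \<Longrightarrow> hausdorff_pre n \<epsilon> A \<le> hausdorff_pre n \<delta> A"
  unfolding hausdorff_pre_def by (intro INF_superset_mono) (auto intro: order_trans)

lemma hausdorff_pre_countably_subadditive:
  "hausdorff_pre n \<delta> (\<Union>i. A i) \<le> (\<Sum>i. hausdorff_pre n \<delta> (A i))"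
proof (rule ennreal_le_epsilon)
  fix e :: real
  assume e: "0 < e" and fin: "(\<Sum>i. hausdorff_pre n \<delta> (A i)) < top"
  have less: "hausdorff_pre n \<delta> (A i) < hausdorff_pre n \<delta> (A i) + e * (1/2)^Suc i" for i
    using e fin by (auto simp add: less_top dest!: ennreal_suminf_lessD)
  have "\<exists>U. A i \<subseteq> (\<Union>j. U j) \<and> (\<forall>j. bounded (U j) \<and> diameter (U j) \<le> \<delta>) \<and>
          (\<Sum>j. hausdorff_weight n (U j)) \<le> hausdorff_pre n \<delta> (A i) + e * (1/2)^Suc i" for i
    using less[of i] unfolding hausdorff_pre_def[of _ _ "A i"] INF_less_iff
    by (auto intro: less_imp_le)
  then obtain U where U: "\<And>i. A i \<subseteq> (\<Union>j. U i j)" "\<And>i j. bounded (U i j)"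
      "\<And>i j. diameter (U i j) \<le> \<delta>"
      "\<And>i. (\<Sum>j. hausdorff_weight n (U i j)) \<le> hausdorff_pre n \<delta> (A i) + e * (1/2)^Suc i"
    by metis
  define C where "C = case_prod U o prod_decode"
  have "(\<Union>i. A i) \<subseteq> (\<Union>i. C i)"
    using U(1) by (auto simp add: C_def subset_eq) (metis prod.case prod_encode_inverse)
  then have "hausdorff_pre n \<delta> (\<Union>i. A i) \<le> (\<Sum>i. hausdorff_weight n (C i))"
    using U(2,3) by (intro hausdorff_pre_le) (auto simp: C_def split_def)
  also have "\<dots> = (\<Sum>i. \<Sum>j. hausdorff_weight n (U i j))"
    using suminf_ennreal_2dimen[of "\<lambda>i. \<Sum>j. hausdorff_weight n (U i j)"
        "\<lambda>(i, j). hausdorff_weight n (U i j)"]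
    by (simp add: C_def comp_def split_def)
  also have "\<dots> \<le> (\<Sum>i. hausdorff_pre n \<delta> (A i) + e * (1/2) ^ Suc i)"
    by (intro suminf_le U(4)) auto
  also have "\<dots> = (\<Sum>i. hausdorff_pre n \<delta> (A i)) + (\<Sum>i. ennreal e * ennreal ((1/2) ^ Suc i))"
    using e by (subst suminf_add[symmetric])
      (auto simp del: ennreal_suminf_cmult simp add: ennreal_mult[symmetric])
  also have "\<dots> = (\<Sum>i. hausdorff_pre n \<delta> (A i)) + e"
    unfolding ennreal_suminf_cmult
    by (subst suminf_ennreal_eq[OF zero_le_power power_half_series]) auto
  finally show "hausdorff_pre n \<delta> (\<Union>i. A i) \<le> (\<Sum>i. hausdorff_pre n \<delta> (A i)) + e" .
qed

lemma hausdorff_outer_empty [simp]: "hausdorff_outer n {} = 0"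
proof -
  have "hausdorff_outer n ({} :: 'a set) \<le> 0"
    unfolding hausdorff_outer_def by (intro SUP_least) (simp add: hausdorff_pre_empty)
  then show ?thesis by simp
qed

lemma hausdorff_outer_mono: "A \<subseteq> B \<Longrightarrow> hausdorff_outer n A \<le> hausdorff_outer n B"
  unfolding hausdorff_outer_def by (intro SUP_mono) (auto intro: hausdorff_pre_mono)

lemma hausdorff_outer_countably_subadditive:
  "hausdorff_outer n (\<Union>i. A i) \<le> (\<Sum>i. hausdorff_outer n (A i))"
  unfolding hausdorff_outer_def[of _ "\<Union>i. A i"]
proof (rule SUP_least)
  fix \<delta> :: real assume \<delta>: "\<delta> \<in> {0<..}"
  have "hausdorff_pre n \<delta> (A i) \<le> hausdorff_outer n (A i)" for i
    unfolding hausdorff_outer_def using \<delta> by (rule SUP_upper)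
  then have "(\<Sum>i. hausdorff_pre n \<delta> (A i)) \<le> (\<Sum>i. hausdorff_outer n (A i))"
    by (intro suminf_le) auto
  then show "hausdorff_pre n \<delta> (\<Union>i. A i) \<le> (\<Sum>i. hausdorff_outer n (A i))"
    using hausdorff_pre_countably_subadditive order_trans by blast
qed

lemma outer_measure_space_hausdorff_outer:
  "outer_measure_space (Pow UNIV) (hausdorff_outer n)"
  unfolding outer_measure_space_def
  by (simp add: positive_def increasing_def countably_subadditive_def
      hausdorff_outer_mono hausdorff_outer_countably_subadditive)

lemma hausdorff_outer_subadditive:
  "hausdorff_outer n (A \<union> B) \<le> hausdorff_outer n A + hausdorff_outer n B"
proof -
  have "subadditive (Pow UNIV) (hausdorff_outer n)"
    using outer_measure_space_hausdorff_outer[of n] unfolding outer_measure_space_def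
    by (intro ring_of_sets.countably_subadditive_subadditive[OF ring_of_sets_Pow]) auto
  then have "hausdorff_outer n (A \<union> (B - A)) \<le> hausdorff_outer n A + hausdorff_outer n (B - A)"
    by (rule subadditiveD) auto
  then show ?thesis
    by (metis Un_Diff_cancel add_left_mono hausdorff_outer_mono Diff_subset order_trans)
qed

lemma hausdorff_pre_separated:
  assumes "\<And>x y. x \<in> A \<Longrightarrow> y \<in> B \<Longrightarrow> \<delta> < dist x y" "\<delta> > 0"
  shows "hausdorff_pre n \<delta> A + hausdorff_pre n \<delta> B \<le> hausdorff_pre n \<delta> (A \<union> B)"
  unfolding hausdorff_pre_def[of _ _ "A \<union> B"]
proof (rule INF_greatest, clarify)
  fix U :: "nat \<Rightarrow> 'a set"
  assume sub: "A \<union> B \<subseteq> (\<Union>i. U i)" and U: "\<forall>i. bounded (U i) \<and> diameter (U i) \<le> \<delta>"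
  define V where "V C i = (if U i \<inter> C = {} then {} else U i)" for C i
  have pre: "hausdorff_pre n \<delta> C \<le> (\<Sum>i. hausdorff_weight n (V C i))" if "C \<subseteq> A \<union> B" for C
  proof (rule hausdorff_pre_le)
    show "C \<subseteq> (\<Union>i. V C i)"
    proof
      fix x assume "x \<in> C"
      then obtain i where "x \<in> U i" using sub \<open>C \<subseteq> A \<union> B\<close> by blast
      with \<open>x \<in> C\<close> have "x \<in> V C i" by (auto simp: V_def)
      then show "x \<in> (\<Union>i. V C i)" by blast
    qed
  qed (use U assms(2) in \<open>auto simp: V_def\<close>)
  have w: "hausdorff_weight n (V A i) + hausdorff_weight n (V B i) \<le> hausdorff_weight n (U i)" for i
  proof -
    have False if xy: "x \<in> U i" "x \<in> A" "y \<in> U i" "y \<in> B" for x y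
    proof -
      have "dist x y \<le> diameter (U i)" using U xy by (intro diameter_bounded_bound) auto
      also have "\<dots> \<le> \<delta>" using U by blast
      finally show False using assms(1)[OF xy(2,4)] by simp
    qed
    then have "U i \<inter> A = {} \<or> U i \<inter> B = {}" by blast
    then show ?thesis by (auto simp: V_def)
  qed
  have "hausdorff_pre n \<delta> A + hausdorff_pre n \<delta> B
      \<le> (\<Sum>i. hausdorff_weight n (V A i)) + (\<Sum>i. hausdorff_weight n (V B i))"
    by (intro add_mono pre) auto
  also have "\<dots> = (\<Sum>i. hausdorff_weight n (V A i) + hausdorff_weight n (V B i))"
    by (intro suminf_add) auto
  also have "\<dots> \<le> (\<Sum>i. hausdorff_weight n (U i))"
    by (intro suminf_le w) auto
  finally show "hausdorff_pre n \<delta> A + hausdorff_pre n \<delta> B \<le> (\<Sum>i. hausdorff_weight n (U i))" .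
qed

lemma hausdorff_outer_separated:
  assumes "\<And>x y. x \<in> A \<Longrightarrow> y \<in> B \<Longrightarrow> \<epsilon> \<le> dist x y" "\<epsilon> > 0"
  shows "hausdorff_outer n A + hausdorff_outer n B \<le> hausdorff_outer n (A \<union> B)"
proof -
  have *: "hausdorff_pre n \<delta> A + hausdorff_pre n \<delta>' B \<le> hausdorff_outer n (A \<union> B)"
    if "\<delta> > 0" "\<delta>' > 0" for \<delta> \<delta>'
  proof -
    define d where "d = Min {\<delta>, \<delta>', \<epsilon>/2}"
    have d: "d > 0" "d \<le> \<delta>" "d \<le> \<delta>'" "d < \<epsilon>" using that assms(2) by (auto simp: d_def min_def)
    have "hausdorff_pre n \<delta> A + hausdorff_pre n \<delta>' B \<le> hausdorff_pre n d A + hausdorff_pre n d B"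
      using d by (intro add_mono hausdorff_pre_antimono)
    also have "\<dots> \<le> hausdorff_pre n d (A \<union> B)"
      using d assms(1) by (intro hausdorff_pre_separated) force+
    also have "\<dots> \<le> hausdorff_outer n (A \<union> B)"
      unfolding hausdorff_outer_def using d(1) by (intro SUP_upper) auto
    finally show ?thesis .
  qed
  have ne: "{0::real<..} \<noteq> {}" by (auto intro: exI[of _ 1])
  have "hausdorff_pre n \<delta> A + hausdorff_outer n B \<le> hausdorff_outer n (A \<union> B)" if "\<delta> > 0" for \<delta>
  proof -
    have "hausdorff_pre n \<delta> A + hausdorff_outer n B
        = (SUP \<delta>' \<in> {0<..}. hausdorff_pre n \<delta> A + hausdorff_pre n \<delta>' B)"
      unfolding hausdorff_outer_def[of _ B] by (rule ennreal_SUP_add_right[OF ne])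
    also have "\<dots> \<le> hausdorff_outer n (A \<union> B)" using that * by (intro SUP_least) auto
    finally show ?thesis .
  qed
  moreover have "hausdorff_outer n A + hausdorff_outer n B
      = (SUP \<delta> \<in> {0<..}. hausdorff_pre n \<delta> A + hausdorff_outer n B)"
    unfolding hausdorff_outer_def[of _ A] by (rule ennreal_SUP_add_left[OF ne, symmetric])
  ultimately show ?thesis by (auto intro!: SUP_least)
qed

lemma ennreal_suminf_tail_tendsto:
  fixes f :: "nat \<Rightarrow> ennreal"
  assumes "(\<Sum>i. f i) < top" "e > (0::real)"
  obtains m where "(\<Sum>i. f (i + m)) \<le> e"
proof -
  define g where "g i = enn2real (f i)" for i
  have "f i < top" for i using ennreal_suminf_lessD[OF assms(1)] .
  then have fg: "f i = ennreal (g i)" for i by (simp add: g_def)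
  have g0: "g i \<ge> 0" for i by (simp add: g_def)
  have sg: "summable g"
    using assms(1) g0 by (intro summable_suminf_not_top) (auto simp: fg)
  from suminf_exist_split[OF assms(2) this] obtain m where m: "norm (\<Sum>i. g (i + m)) < e" by blast
  have "summable (\<lambda>i. g (i + m))" using sg by (simp add: summable_iff_shift)
  then have "(\<Sum>i. f (i + m)) = ennreal (\<Sum>i. g (i + m))"
    using g0 by (simp add: fg suminf_ennreal2)
  also have "\<dots> \<le> e" using m by (intro ennreal_leI) auto
  finally show ?thesis by (rule that)
qed

lemma hausdorff_outer_closed:
  fixes F :: "'a::metric_space set"
  assumes "closed F"
  shows "hausdorff_outer n (A \<inter> F) + hausdorff_outer n (A - F) = hausdorff_outer n A"
proof (rule antisym)
  have "hausdorff_outer n ((A \<inter> F) \<union> (A - F)) \<le> hausdorff_outer n (A \<inter> F) + hausdorff_outer n (A - F)"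
    by (rule hausdorff_outer_subadditive)
  then show "hausdorff_outer n A \<le> hausdorff_outer n (A \<inter> F) + hausdorff_outer n (A - F)"
    by (simp add: Int_Diff_Un)
next
  let ?\<mu> = "hausdorff_outer n :: 'a set \<Rightarrow> ennreal"
  show "?\<mu> (A \<inter> F) + ?\<mu> (A - F) \<le> ?\<mu> A"
  proof (cases "F = {} \<or> ?\<mu> A = top")
    case True
    then show ?thesis by auto
  next
    case False
    then have ne: "F \<noteq> {}" and fin: "?\<mu> A < top" by (auto simp: less_top)
    define B where "B k = {x \<in> A. infdist x F \<ge> 1 / Suc k}" for k
    define R where "R k = B (Suc k) - B k" for k
    have Bsub: "B k \<subseteq> A" for k by (auto simp: B_def)
    have Bmono: "B k \<subseteq> B l" if "k \<le> l" for k l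
    proof -
      have "1 / real (Suc l) \<le> 1 / Suc k" using that by (simp add: frac_le)
      then show ?thesis by (force simp: B_def)
    qed
    have B_union: "A - F = (\<Union>k. B k)"
    proof (intro equalityI subsetI)
      fix x assume x: "x \<in> A - F"
      then have "infdist x F > 0"
        using assms ne by (simp add: infdist_pos_not_in_closed)
      then obtain k where "inverse (Suc k) < infdist x F" using reals_Archimedean by blast
      then have "x \<in> B k" using x by (auto simp: B_def inverse_eq_divide)
      then show "x \<in> (\<Union>k. B k)" by blast
    next
      fix x assume "x \<in> (\<Union>k. B k)"
      then obtain k where k: "x \<in> A" "infdist x F \<ge> 1 / Suc k" by (auto simp: B_def)
      moreover have "(0::real) < 1 / Suc k" by simp
      ultimately have "infdist x F \<noteq> 0" by linarith
      then show "x \<in> A - F" using k by auto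
    qed
    have R_sep: "?\<mu> S + ?\<mu> (R k) \<le> ?\<mu> (S \<union> R k)" if "S \<subseteq> B j" "j < k" for S j k
    proof (rule hausdorff_outer_separated[where \<epsilon> = "1 / Suc j - 1 / Suc k"])
      fix x y assume "x \<in> S" "y \<in> R k"
      then have "infdist x F \<ge> 1 / Suc j" "infdist y F \<le> 1 / Suc k"
        using that by (auto simp: B_def R_def)
      then show "1 / Suc j - 1 / Suc k \<le> dist x y"
        using infdist_triangle[of x F y] by linarith
    next
      show "0 < 1 / real (Suc j) - 1 / Suc k" using that by (simp add: frac_less2)
    qed
    have alt: "(\<Sum>k<m. ?\<mu> (R (2*k+e))) \<le> ?\<mu> (\<Union>k<m. R (2*k+e))" for m e
    proof (induction m)
      case (Suc m)
      show ?case
      proof (cases m)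
        case (Suc m')
        have sub: "(\<Union>k<m. R (2*k+e)) \<subseteq> B (2*m'+e+1)"
        proof clarify
          fix x k assume "k < m" "x \<in> R (2*k+e)"
          then have "x \<in> B (Suc (2*k+e))" by (auto simp: R_def)
          then show "x \<in> B (2*m'+e+1)"
            using Bmono[of "Suc (2*k+e)" "2*m'+e+1"] \<open>k < m\<close> Suc by auto
        qed
        have "(\<Sum>k<Suc m. ?\<mu> (R (2*k+e))) \<le> ?\<mu> (\<Union>k<m. R (2*k+e)) + ?\<mu> (R (2*m+e))"
          using Suc.IH by (simp add: add_right_mono)
        also have "\<dots> \<le> ?\<mu> ((\<Union>k<m. R (2*k+e)) \<union> R (2*m+e))"
          by (rule R_sep[OF sub]) (simp add: Suc)
        also have "(\<Union>k<m. R (2*k+e)) \<union> R (2*m+e) = (\<Union>k<Suc m. R (2*k+e))"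
          by (auto simp: lessThan_Suc)
        finally show ?thesis .
      qed (simp add: lessThan_Suc)
    qed simp
    have alt': "(\<Sum>k<m. ?\<mu> (R (2*k+e))) \<le> ?\<mu> A" for m e
    proof -
      have "(\<Union>k<m. R (2*k+e)) \<subseteq> A" using Bsub by (auto simp: R_def)
      then show ?thesis using alt[of e m] hausdorff_outer_mono order_trans by blast
    qed
    have split: "(\<Sum>k<2*m. ?\<mu> (R k)) = (\<Sum>k<m. ?\<mu> (R (2*k+0))) + (\<Sum>k<m. ?\<mu> (R (2*k+1)))" for m
      by (induction m) (auto simp: algebra_simps)
    have "(\<Sum>k<m. ?\<mu> (R k)) \<le> ?\<mu> A + ?\<mu> A" for m
    proof -
      have "(\<Sum>k<m. ?\<mu> (R k)) \<le> (\<Sum>k<2*m. ?\<mu> (R k))" by (intro sum_mono2) auto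
      also have "\<dots> \<le> ?\<mu> A + ?\<mu> A" unfolding split by (intro add_mono alt')
      finally show ?thesis .
    qed
    then have "(\<Sum>k. ?\<mu> (R k)) \<le> ?\<mu> A + ?\<mu> A"
      by (intro suminf_le_const) auto
    then have sumfin: "(\<Sum>k. ?\<mu> (R k)) < top"
      using fin by (auto intro: order_le_less_trans)
    show ?thesis
    proof (rule ennreal_le_epsilon)
      fix e :: real assume "e > 0"
      from ennreal_suminf_tail_tendsto[OF sumfin this]
      obtain m where m: "(\<Sum>i. ?\<mu> (R (i + m))) \<le> e" by blast
      have "B k \<subseteq> B m \<union> (\<Union>i. R (i + m))" for k
      proof (induction k)
        case 0 then show ?case using Bmono[of 0 m] by auto
      next
        case (Suc k)
        show ?case
        proof (cases "Suc k \<le> m")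
          case True then show ?thesis using Bmono by blast
        next
          case False
          then have "k = (k - m) + m" by simp
          then have "R k \<subseteq> (\<Union>i. R (i + m))" by (metis UN_upper UNIV_I)
          moreover have "B (Suc k) \<subseteq> B k \<union> R k" by (auto simp: R_def)
          ultimately show ?thesis using Suc by blast
        qed
      qed
      then have "A - F \<subseteq> B m \<union> (\<Union>i. R (i + m))" unfolding B_union by blast
      then have "?\<mu> (A - F) \<le> ?\<mu> (B m \<union> (\<Union>i. R (i + m)))" by (rule hausdorff_outer_mono)
      also have "\<dots> \<le> ?\<mu> (B m) + ?\<mu> (\<Union>i. R (i + m))" by (rule hausdorff_outer_subadditive)
      also have "\<dots> \<le> ?\<mu> (B m) + e"
        using hausdorff_outer_countably_subadditive[of n "\<lambda>i. R (i + m)"] m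
        by (intro add_left_mono) (rule order_trans)
      finally have "?\<mu> (A \<inter> F) + ?\<mu> (A - F) \<le> (?\<mu> (A \<inter> F) + ?\<mu> (B m)) + e"
        by (simp add: add_left_mono add.assoc)
      also have "?\<mu> (A \<inter> F) + ?\<mu> (B m) \<le> ?\<mu> ((A \<inter> F) \<union> B m)"
      proof (rule hausdorff_outer_separated[where \<epsilon> = "1 / Suc m"])
        fix x y assume "x \<in> A \<inter> F" "y \<in> B m"
        then have "infdist x F = 0" "infdist y F \<ge> 1 / Suc m" by (auto simp: B_def)
        then show "1 / Suc m \<le> dist x y" 
          using infdist_triangle[of y F x] by (simp add: dist_commute)
      qed simp
      also have "?\<mu> ((A \<inter> F) \<union> B m) \<le> ?\<mu> A"
        using Bsub by (intro hausdorff_outer_mono) auto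
      finally show "?\<mu> (A \<inter> F) + ?\<mu> (A - F) \<le> ?\<mu> A + e" by (simp add: add_right_mono)
    qed
  qed
qed

lemma measure_space_hausdorff_outer: "measure_space UNIV (sets borel) (hausdorff_outer n)"
proof -
  interpret P: sigma_algebra UNIV "Pow UNIV :: 'a set set" by (rule sigma_algebra_Pow)
  let ?L = "lambda_system UNIV (Pow UNIV) (hausdorff_outer n) :: 'a set set"
  have L: "measure_space UNIV ?L (hausdorff_outer n)"
    by (rule P.caratheodory_lemma[OF outer_measure_space_hausdorff_outer])
  then have salg: "sigma_algebra UNIV ?L" by (simp add: measure_space_def)
  have "{S. closed S} \<subseteq> ?L"
    using hausdorff_outer_closed[where n = n]
    by (auto simp: lambda_system_def Int_commute Diff_eq Compl_eq_Diff_UNIV[symmetric])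
  then have "sigma_sets UNIV {S. closed S} \<subseteq> ?L"
    by (rule sigma_algebra.sigma_sets_subset[OF salg])
  moreover have "sets (borel :: 'a measure) = sigma_sets UNIV {S. closed S}"
    by (simp add: borel_eq_closed)
  ultimately have "sets borel \<subseteq> ?L" by simp
  moreover have "sigma_algebra UNIV (sets (borel :: 'a measure))"
    using sets.sigma_algebra_axioms[of "borel :: 'a measure"] by simp
  ultimately show ?thesis by (intro measure_down[OF L])
qed

lemma emeasure_hausdorff_measure:
  "A \<in> sets borel \<Longrightarrow> emeasure (hausdorff_measure n) A = hausdorff_outer n A"
  using measure_space_hausdorff_outer[of n]
  by (intro emeasure_measure_of[OF hausdorff_measure_def]) (auto simp: measure_space_def)


section \<open>Circumscribed convex bodies\<close>

definition surface_measure :: "'a::euclidean_space measure" where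
  "surface_measure = hausdorff_measure (DIM('a) - 1)"

definition convex_body :: "'a::euclidean_space set \<Rightarrow> bool" where
  "convex_body K \<longleftrightarrow> convex K \<and> compact K \<and> interior K \<noteq> {}"

definition supporting_hyperplane :: "'a::euclidean_space set \<Rightarrow> 'a \<Rightarrow> 'a set \<Rightarrow> bool" where
  "supporting_hyperplane K x H \<longleftrightarrow>
     x \<in> H \<and> (\<exists>u b. u \<noteq> 0 \<and> H = {y. u \<bullet> y = b} \<and> K \<subseteq> {y. u \<bullet> y \<le> b})"

text \<open>
  If two different hyperplanes supporting \<open>K\<close> at \<open>x\<close> both had distance \<open>r\<close> from \<open>c\<close>, one with
  an intermediate normal would have a larger distance. Hence asking every supporting hyperplane
  at \<open>x\<close> to be tangent amounts to asking that there is exactly one and that it is tangent.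
\<close>

definition inscribed_sphere :: "'a::euclidean_space set \<Rightarrow> 'a \<Rightarrow> real \<Rightarrow> bool" where
  "inscribed_sphere K c r \<longleftrightarrow> r > 0 \<and> cball c r \<subseteq> K \<and>
     (AE x in surface_measure. x \<in> frontier K \<longrightarrow>
        (\<forall>H. supporting_hyperplane K x H \<longrightarrow> infdist c H = r))"


section \<open>Distributions on the boundary\<close>

text \<open>
  Distributions on the boundary are Borel measures on the ambient space that are concentrated
  on the boundary.
\<close>

definition uniform_boundary_distribution :: "'a::euclidean_space set \<Rightarrow> 'a measure" where
  "uniform_boundary_distribution K = uniform_measure surface_measure (frontier K)"

text \<open>
  The point where the ray from \<open>c\<close> through \<open>z\<close> meets the boundary. For \<open>z = c\<close> the
  value is unspecified, which is irrelevant below since points are Lebesgue null sets.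
\<close>

definition radial_projection :: "'a::euclidean_space set \<Rightarrow> 'a \<Rightarrow> 'a \<Rightarrow> 'a" where
  "radial_projection K c z = (THE y. y \<in> frontier K \<and> (\<exists>t\<ge>0. y = c + t *\<^sub>R (z - c)))"

lemma radial_projection_ex1:
  fixes K :: "'a::euclidean_space set"
  assumes "convex K" "bounded K" "c \<in> interior K" "z \<noteq> c"
  shows "\<exists>!y. y \<in> frontier K \<and> (\<exists>t\<ge>0. y = c + t *\<^sub>R (z - c))"
proof -
  obtain d where d: "0 < d" "c + d *\<^sub>R (z - c) \<in> frontier K"
    using ray_to_frontier[OF assms(2,3), of "z - c"] assms(4) by auto
  have less: False if st: "0 \<le> s" "s < t" "c + s *\<^sub>R (z - c) \<in> frontier K" "c + t *\<^sub>R (z - c) \<in> frontier K"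
    for s t
  proof -
    have "c + t *\<^sub>R (z - c) \<in> closure K" using st(4) by (simp add: frontier_def)
    then have "(c + t *\<^sub>R (z - c)) - (1 - s / t) *\<^sub>R ((c + t *\<^sub>R (z - c)) - c) \<in> interior K"
      using st by (intro mem_interior_closure_convex_shrink[OF assms(1,3)]) auto
    also have "(c + t *\<^sub>R (z - c)) - (1 - s / t) *\<^sub>R ((c + t *\<^sub>R (z - c)) - c) = c + s *\<^sub>R (z - c)"
      using st by (simp add: algebra_simps)
    finally show False using st(3) by (simp add: frontier_def)
  qed
  show ?thesis
  proof (rule ex1I[of _ "c + d *\<^sub>R (z - c)"])
    show "c + d *\<^sub>R (z - c) \<in> frontier K \<and> (\<exists>t\<ge>0. c + d *\<^sub>R (z - c) = c + t *\<^sub>R (z - c))"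
      using d by (auto intro: exI[of _ d])
  next
    fix y assume "y \<in> frontier K \<and> (\<exists>t\<ge>0. y = c + t *\<^sub>R (z - c))"
    then obtain t where t: "t \<ge> 0" "y = c + t *\<^sub>R (z - c)" "y \<in> frontier K" by blast
    then have "\<not> t < d" "\<not> d < t" using less[of t d] less[of d t] d by auto
    then show "y = c + d *\<^sub>R (z - c)" using t by simp
  qed
qed

definition projective_distribution :: "'a::euclidean_space set \<Rightarrow> 'a \<Rightarrow> 'a measure" where
  "projective_distribution K c =
     distr (uniform_measure lborel K) borel (radial_projection K c)"

end

theory Submission
  imports Defs
begin

text \<open>
  Write \<open>H\<close> for surface measure and \<open>\<nu> A\<close> for the volume of the cone with apex \<open>c\<close> over a part
  \<open>A\<close> of the boundary. The claim is that \<open>H\<close> and \<open>\<nu>\<close> are proportional on the boundary.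

  On the hyperplane with unit normal \<open>u\<close> at distance \<open>r\<close> from \<open>c\<close>, both \<open>H\<close> and the cone volume
  are invariant under translations, the latter because a shear that fixes \<open>c\<close> and moves the
  hyperplane along itself preserves volume. Translation-invariant measures are proportional (by
  Fubini), and the factor does not depend on \<open>u\<close> because rotations preserve both measures.

  At almost every boundary point \<open>x\<close> the supporting hyperplane is unique and has distance \<open>r\<close>
  from \<open>c\<close>. By compactness, the normals at nearby boundary points are close to the one at \<open>x\<close>,
  so the central projection from \<open>c\<close> onto that hyperplane changes distances, and hence \<open>H\<close>, only
  by a factor close to \<open>1\<close> near \<open>x\<close>. It also hardly changes cone volumes. So \<open>H\<close> and \<open>\<nu>\<close> are
  proportional near \<open>x\<close> up to factors arbitrarily close to \<open>1\<close>, and a countable cover makes this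
  global. The exceptional \<open>H\<close>-null set is \<open>\<nu>\<close>-null by the Lipschitz bounds for central projections
  onto the hyperplanes with normals among the signed basis vectors.

  The normalisation of \<open>H\<close> is never needed, and \<open>0 < H (frontier K) < \<infinity>\<close> is read off from the
  existence of a uniformly distributed \<open>Y\<close>.
\<close>

section \<open>Hausdorff measure under Lipschitz maps\<close>

text \<open>Push a cover of \<open>A\<close> forward: the images of the sets
  \<open>U i \<inter> A\<close> have diameters at most \<open>L\<close> times and weights at most
  \<open>L ^ n\<close> times those of \<open>U i\<close>. The sets are cut down to \<open>A\<close>
  because \<open>f\<close> is controlled only there.\<close>

lemma hausdorff_pre_lipschitz_image:
  fixes f :: "'a::metric_space \<Rightarrow> 'b::metric_space"
  assumes L: "L > 0" and f: "\<And>x y. x \<in> A \<Longrightarrow> y \<in> A \<Longrightarrow> dist (f x) (f y) \<le> L * dist x y"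
  shows "hausdorff_pre n (L * \<delta>) (f ` A) \<le> ennreal (L ^ n) * hausdorff_pre n \<delta> A"
proof -
  have Ln: "ennreal (L ^ n) \<noteq> 0" "ennreal (L ^ n) \<noteq> top" using L by auto
  \<comment> \<open>Divided by \<open>L ^ n\<close>, the claim is a lower bound of an infimum and
    can be checked cover by cover.\<close>
  have "hausdorff_pre n (L * \<delta>) (f ` A) / ennreal (L ^ n) \<le> hausdorff_pre n \<delta> A"
    unfolding hausdorff_pre_def[of n \<delta> A]
  proof (rule INF_greatest, clarify)
    fix U :: "nat \<Rightarrow> 'a set"
    assume sub: "A \<subseteq> (\<Union>i. U i)" and U: "\<forall>i. bounded (U i) \<and> diameter (U i) \<le> \<delta>"
    have img: "dist (f x) (f y) \<le> L * diameter (U i)" if "x \<in> U i \<inter> A" "y \<in> U i \<inter> A" for x y i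
    proof -
      have "dist x y \<le> diameter (U i)" using U that by (intro diameter_bounded_bound) auto
      then show ?thesis using f[of x y] that L by (auto intro: order_trans mult_left_mono)
    qed
    have diam0: "0 \<le> diameter (U i)" for i using U by (simp add: diameter_ge_0)
    have bd: "bounded (f ` (U i \<inter> A))" for i
      unfolding bounded_two_points using img by blast
    have diam: "diameter (f ` (U i \<inter> A)) \<le> L * diameter (U i)" for i
      proof (cases "U i \<inter> A = {}")
      case False
      then show ?thesis
        unfolding diameter_def[of "f ` (U i \<inter> A)"] using img[of _ i]
        by (auto intro!: cSUP_least)
    qed (use L diam0[of i] in simp)
    have weight: "hausdorff_weight n (f ` (U i \<inter> A)) \<le> ennreal (L ^ n) * hausdorff_weight n (U i)" for i
    proof (cases "U i \<inter> A = {}")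
      case False
      then have ne: "U i \<noteq> {}" "f ` (U i \<inter> A) \<noteq> {}" by auto
      have "(diameter (f ` (U i \<inter> A)) / 2) ^ n \<le> (L * diameter (U i) / 2) ^ n"
        using diam[of i] bd[of i] by (intro power_mono) (auto simp: diameter_ge_0)
      also have "\<dots> = L ^ n * (diameter (U i) / 2) ^ n"
        by (simp add: power_mult_distrib power_divide)
      finally have "unit_ball_vol n * (diameter (f ` (U i \<inter> A)) / 2) ^ n
          \<le> L ^ n * (unit_ball_vol n * (diameter (U i) / 2) ^ n)"
        by (metis mult.left_commute mult_left_mono unit_ball_vol_nonneg of_nat_0_le_iff)
      then show ?thesis
        using ne L diam0[of i] unfolding hausdorff_weight_def
        by (simp add: ennreal_mult[symmetric] unit_ball_vol_nonneg)
    qed simp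
    have "hausdorff_pre n (L * \<delta>) (f ` A) \<le> (\<Sum>i. hausdorff_weight n (f ` (U i \<inter> A)))"
    proof (rule hausdorff_pre_le)
      show "f ` A \<subseteq> (\<Union>i. f ` (U i \<inter> A))" using sub by blast
      show "diameter (f ` (U i \<inter> A)) \<le> L * \<delta>" for i
        using diam[of i] U L by (meson mult_left_mono order_trans less_imp_le)
    qed (rule bd)
    also have "\<dots> \<le> (\<Sum>i. ennreal (L ^ n) * hausdorff_weight n (U i))"
      by (intro suminf_le weight) auto
    finally show "hausdorff_pre n (L * \<delta>) (f ` A) / ennreal (L ^ n) \<le> (\<Sum>i. hausdorff_weight n (U i))"
      using L by (intro divide_le_posI_ennreal) (auto simp: mult.commute)
  qed
  then have "ennreal (L ^ n) * (hausdorff_pre n (L * \<delta>) (f ` A) / ennreal (L ^ n))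
      \<le> ennreal (L ^ n) * hausdorff_pre n \<delta> A"
    by (rule mult_left_mono) simp
  then show ?thesis
    using Ln by (metis ennreal_times_divide mult_divide_eq_ennreal mult.commute)
qed

lemma hausdorff_outer_lipschitz_image:
  fixes f :: "'a::metric_space \<Rightarrow> 'b::metric_space"
  assumes L: "L > 0" and f: "\<And>x y. x \<in> A \<Longrightarrow> y \<in> A \<Longrightarrow> dist (f x) (f y) \<le> L * dist x y"
  shows "hausdorff_outer n (f ` A) \<le> ennreal (L ^ n) * hausdorff_outer n A"
  unfolding hausdorff_outer_def[of n "f ` A"]
proof (rule SUP_least)
  fix \<delta> :: real assume \<delta>: "\<delta> \<in> {0<..}"
  have "hausdorff_pre n \<delta> (f ` A) = hausdorff_pre n (L * (\<delta> / L)) (f ` A)" using L by simp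
  also have "\<dots> \<le> ennreal (L ^ n) * hausdorff_pre n (\<delta> / L) A"
    using assms by (rule hausdorff_pre_lipschitz_image)
  also have "\<dots> \<le> ennreal (L ^ n) * hausdorff_outer n A"
    unfolding hausdorff_outer_def using \<delta> L by (intro mult_left_mono SUP_upper) auto
  finally show "hausdorff_pre n \<delta> (f ` A) \<le> ennreal (L ^ n) * hausdorff_outer n A" .
qed

lemma hausdorff_outer_isometric_image:
  fixes f :: "'a::metric_space \<Rightarrow> 'b::metric_space"
  assumes f: "\<And>x y. dist (f x) (f y) = dist x y"
  shows "hausdorff_outer n (f ` A) = hausdorff_outer n A"
proof (rule antisym)
  have inj: "inj f" by (rule injI) (metis f dist_eq_0_iff)
  show "hausdorff_outer n (f ` A) \<le> hausdorff_outer n A"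
    using hausdorff_outer_lipschitz_image[of 1 A f n] f by simp
  have "dist (inv f x) (inv f y) \<le> 1 * dist x y" if "x \<in> f ` A" "y \<in> f ` A" for x y
    using that inj f by (auto simp: inv_f_f)
  from hausdorff_outer_lipschitz_image[OF _ this]
  have "hausdorff_outer n (inv f ` f ` A) \<le> hausdorff_outer n (f ` A)"
    by (metis ennreal_1 mult_1 power_one zero_less_one)
  then show "hausdorff_outer n A \<le> hausdorff_outer n (f ` A)"
    using inj by (simp add: image_comp)
qed

section \<open>Translation-invariant measures\<close>

text \<open>Uniqueness of Haar measure: integrate \<open>indicator A x * indicator B (y + x)\<close>
  over both variables and shift in two ways. Invariance holds along \<open>W\<close>, and almost all
  shift vectors lie in \<open>W\<close>. The second evaluation leaves the reflection of
  \<open>A\<close>. Products instead of quotients avoid trouble with \<open>0\<close> and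
  \<open>\<infinity>\<close>.\<close>

lemma translation_invariant_measures_proportional:
  fixes M1 M2 :: "'a::euclidean_space measure"
  assumes sf: "sigma_finite_measure M1" "sigma_finite_measure M2"
    and sets [measurable_cong, simp]: "sets M1 = sets borel" "sets M2 = sets borel"
    and W: "subspace W" "AE x in M1. x \<in> W" "AE x in M2. x \<in> W"
    and inv1: "\<And>w. w \<in> W \<Longrightarrow> distr M1 borel (\<lambda>x. x + w) = M1"
    and inv2: "\<And>w. w \<in> W \<Longrightarrow> distr M2 borel (\<lambda>x. x + w) = M2"
    and A [measurable]: "A \<in> sets borel" and B [measurable]: "B \<in> sets borel"
  shows "emeasure M1 A * emeasure M2 B = emeasure M1 B * emeasure M2 (uminus -` A)"
proof -
  interpret M1: sigma_finite_measure M1 by fact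
  interpret M2: sigma_finite_measure M2 by fact
  interpret P: pair_sigma_finite M1 M2 ..
  have [simp]: "space M1 = UNIV" "space M2 = UNIV"
    using sets_eq_imp_space_eq[OF sets(1)] sets_eq_imp_space_eq[OF sets(2)] by auto
  have shift1: "(\<integral>\<^sup>+x. g (x + w) \<partial>M1) = (\<integral>\<^sup>+x. g x \<partial>M1)"
    if [measurable]: "g \<in> borel_measurable borel" and "w \<in> W" for g :: "'a \<Rightarrow> ennreal" and w
  proof -
    have "(\<integral>\<^sup>+x. g x \<partial>M1) = (\<integral>\<^sup>+x. g x \<partial>distr M1 borel (\<lambda>x. x + w))"
      using inv1[OF that(2)] by simp
    also have "\<dots> = (\<integral>\<^sup>+x. g (x + w) \<partial>M1)" by (intro nn_integral_distr) measurable
    finally show ?thesis ..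
  qed
  have shift2: "(\<integral>\<^sup>+x. g (x + w) \<partial>M2) = (\<integral>\<^sup>+x. g x \<partial>M2)"
    if [measurable]: "g \<in> borel_measurable borel" and "w \<in> W" for g :: "'a \<Rightarrow> ennreal" and w
  proof -
    have "(\<integral>\<^sup>+x. g x \<partial>M2) = (\<integral>\<^sup>+x. g x \<partial>distr M2 borel (\<lambda>x. x + w))"
      using inv2[OF that(2)] by simp
    also have "\<dots> = (\<integral>\<^sup>+x. g (x + w) \<partial>M2)" by (intro nn_integral_distr) measurable
    finally show ?thesis ..
  qed
  have uA [measurable]: "uminus -` A \<in> sets borel"
    using measurable_sets[of uminus borel borel A] by simp
  have "emeasure M1 A * emeasure M2 B = (\<integral>\<^sup>+x. indicator A x * emeasure M2 B \<partial>M1)"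
    by (simp add: nn_integral_multc)
  also have "\<dots> = (\<integral>\<^sup>+x. indicator A x * (\<integral>\<^sup>+y. indicator B y \<partial>M2) \<partial>M1)"
    by simp
  also have "\<dots> = (\<integral>\<^sup>+x. \<integral>\<^sup>+y. indicator A x * indicator B (y + x) \<partial>M2 \<partial>M1)"
  proof (rule nn_integral_cong_AE, use W(2) in eventually_elim)
    fix x assume "x \<in> W"
    have "(\<integral>\<^sup>+y. indicator A x * indicator B (y + x) \<partial>M2)
        = indicator A x * (\<integral>\<^sup>+y. indicator B (y + x) \<partial>M2)" by (simp add: nn_integral_cmult)
    then show "indicator A x * (\<integral>\<^sup>+y. indicator B y \<partial>M2)
        = (\<integral>\<^sup>+y. indicator A x * indicator B (y + x) \<partial>M2)"
      using shift2[OF _ \<open>x \<in> W\<close>, of "indicator B"] by simp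
  qed
  also have "\<dots> = (\<integral>\<^sup>+y. \<integral>\<^sup>+x. indicator A x * indicator B (y + x) \<partial>M1 \<partial>M2)"
    by (rule P.Fubini'[symmetric]) measurable
  \<comment> \<open>Shift \<open>x\<close> by \<open>- y\<close> in \<open>M1\<close>.\<close>
  also have "\<dots> = (\<integral>\<^sup>+y. \<integral>\<^sup>+x. indicator A (x - y) * indicator B x \<partial>M1 \<partial>M2)"
  proof (rule nn_integral_cong_AE, use W(3) in eventually_elim)
    fix y assume "y \<in> W"
    then have "- y \<in> W" using W(1) by (simp add: subspace_neg)
    from shift1[OF _ this, of "\<lambda>x. indicator A x * indicator B (y + x)"]
    show "(\<integral>\<^sup>+x. indicator A x * indicator B (y + x) \<partial>M1)
        = (\<integral>\<^sup>+x. indicator A (x - y) * indicator B x \<partial>M1)" by simp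
  qed
  also have "\<dots> = (\<integral>\<^sup>+x. \<integral>\<^sup>+y. indicator A (x - y) * indicator B x \<partial>M2 \<partial>M1)"
    by (rule P.Fubini') measurable
  \<comment> \<open>Shift \<open>y\<close> by \<open>x\<close> in \<open>M2\<close>: then
    \<open>x\<close> drops out of the indicator of \<open>A\<close>, which becomes that of the
    reflected set.\<close>
  also have "\<dots> = (\<integral>\<^sup>+x. emeasure M2 (uminus -` A) * indicator B x \<partial>M1)"
  proof (rule nn_integral_cong_AE, use W(2) in eventually_elim)
    fix x assume x: "x \<in> W"
    have "(\<integral>\<^sup>+y. indicator A (x - y) \<partial>M2) = (\<integral>\<^sup>+y. indicator A (x - (y + x)) \<partial>M2)"
      using shift2[OF _ x, of "\<lambda>y. indicator A (x - y)"] by simp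
    also have "\<dots> = (\<integral>\<^sup>+y. indicator (uminus -` A) y \<partial>M2)"
      by (intro nn_integral_cong) (simp add: indicator_def)
    finally show "(\<integral>\<^sup>+y. indicator A (x - y) * indicator B x \<partial>M2)
        = emeasure M2 (uminus -` A) * indicator B x"
      by (simp add: nn_integral_multc)
  qed
  also have "\<dots> = emeasure M1 B * emeasure M2 (uminus -` A)"
    by (subst nn_integral_cmult) (simp_all add: mult.commute)
  finally show ?thesis .
qed

lemma sigma_finite_measure_cballI:
  fixes M :: "'a::euclidean_space measure"
  assumes "sets M = sets borel" "\<And>n. emeasure M (cball 0 (real n)) < \<infinity>"
  shows "sigma_finite_measure M"
proof
  have "x \<in> (\<Union>n. cball 0 (real n))" for x :: 'a
    using real_arch_simple[of "norm x"] by auto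
  then have "(\<Union>n. cball 0 (real n)) = (UNIV :: 'a set)" by blast
  then show "\<exists>A. countable A \<and> A \<subseteq> sets M \<and> \<Union> A = space M \<and> (\<forall>a\<in>A. emeasure M a \<noteq> \<infinity>)"
    using assms sets_eq_imp_space_eq[OF assms(1)]
    by (intro exI[of _ "range (\<lambda>n. cball 0 (real n))"]) (auto simp: less_top)
qed

lemma lborel_distr_translation: "distr lborel borel (\<lambda>x. x + w) = (lborel :: 'a::euclidean_space measure)"
  using lborel_distr_plus[of w] by (simp add: add.commute[of _ w])

text \<open>The unit ball is its own reflection, so taking it as the first set in the general lemma
  with \<open>W = UNIV\<close> removes the reflection.\<close>

lemma translation_invariant_eq_lborel:
  fixes M :: "'a::euclidean_space measure"
  assumes "sets M = sets borel" "\<And>n. emeasure M (cball 0 (real n)) < \<infinity>"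
    and "\<And>w. distr M borel (\<lambda>x. x + w) = M" and "A \<in> sets borel"
  shows "emeasure M A * emeasure lborel (cball 0 1 :: 'a set) = emeasure lborel A * emeasure M (cball 0 1)"
proof -
  have "(uminus -` cball 0 1 :: 'a set) = cball 0 1" by auto
  then show ?thesis
    using translation_invariant_measures_proportional[of lborel M UNIV "cball 0 1" A,
        OF lborel.sigma_finite_measure_axioms sigma_finite_measure_cballI[OF assms(1,2)]] assms
    by (simp add: mult.commute lborel_distr_translation)
qed

section \<open>Lebesgue measure under orthogonal maps and shears\<close>

lemma emeasure_lborel_cball_pos_finite:
  "0 < r \<Longrightarrow> emeasure lborel (cball c r :: 'a::euclidean_space set) \<noteq> 0"
  "emeasure lborel (cball c r :: 'a::euclidean_space set) \<noteq> \<infinity>"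
  "emeasure lborel (cball c r :: 'a::euclidean_space set) < \<infinity>"
proof -
  show "emeasure lborel (cball c r) \<noteq> \<infinity>" "emeasure lborel (cball c r) < \<infinity>"
    using emeasure_lborel_cball_finite[of c r] by (auto simp: less_top)
  assume "0 < r"
  then show "emeasure lborel (cball c r) \<noteq> 0" using unit_ball_vol_pos[of "real DIM('a)", OF of_nat_0_le_iff, THEN less_imp_neq]
    by (simp add: emeasure_cball del: unit_ball_vol_pos)
qed

text \<open>Translating by \<open>w\<close> after \<open>f\<close> is the same as translating by
  \<open>g w\<close> before \<open>f\<close>, and \<open>lborel\<close> absorbs the latter.\<close>

lemma distr_linear_translation_invariant:
  fixes f g :: "'a::euclidean_space \<Rightarrow> 'a"
  assumes f: "linear f" "\<And>x. f (g x) = x"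
  shows "distr (distr lborel borel f) borel (\<lambda>x. x + w) = distr lborel borel f"
proof -
  have [measurable]: "f \<in> borel_measurable borel"
    using f(1) by (intro borel_measurable_continuous_onI linear_continuous_on)
      (simp add: linear_conv_bounded_linear)
  have "distr (distr lborel borel f) borel (\<lambda>x. x + w) = distr lborel borel (\<lambda>x. f (x + g w))"
    by (subst distr_distr) (auto simp: comp_def linear_add[OF f(1)] f(2))
  also have "\<dots> = distr (distr lborel borel (\<lambda>x. x + g w)) borel f"
    by (subst distr_distr) (auto simp: comp_def)
  also have "\<dots> = distr lborel borel f" by (simp add: lborel_distr_translation)
  finally show ?thesis .
qed

text \<open>The image measure is translation-invariant, hence a multiple of \<open>lborel\<close>;
  the factor is \<open>1\<close> because the unit ball is its own preimage.\<close>

lemma lborel_distr_orthogonal_transformation: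
  fixes f :: "'a::euclidean_space \<Rightarrow> 'a"
  assumes f: "orthogonal_transformation f"
  shows "distr lborel borel f = lborel"
proof (rule measure_eqI)
  have lin: "linear f" and norm: "\<And>x. norm (f x) = norm x"
    using f by (auto simp: orthogonal_transformation)
  have [measurable]: "f \<in> borel_measurable borel"
    using lin by (intro borel_measurable_continuous_onI linear_continuous_on)
      (simp add: linear_conv_bounded_linear)
  let ?M = "distr lborel borel f"
  have ball: "emeasure ?M (cball 0 R) = emeasure lborel (cball 0 R :: 'a set)" for R
  proof -
    have "f -` cball 0 R = cball 0 R" by (auto simp: norm)
    then show ?thesis by (simp add: emeasure_distr)
  qed
  fix A assume "A \<in> sets ?M"
  then have "emeasure ?M A * emeasure lborel (cball 0 1 :: 'a set)
      = emeasure lborel A * emeasure ?M (cball 0 1)"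
    using distr_linear_translation_invariant[OF lin, of "inv f"]
      orthogonal_transformation_surj[OF f]
    by (intro translation_invariant_eq_lborel)
      (auto simp: ball surj_f_inv_f emeasure_lborel_cball_pos_finite[unfolded infinity_ennreal_def])
  then show "emeasure ?M A = emeasure lborel A"
    using emeasure_lborel_cball_pos_finite[where r = 1 and c = "0::'a"]
    by (metis ball mult_divide_eq_ennreal infinity_ennreal_def zero_less_one)
qed simp

lemma orthogonal_transformation_reflection:
  fixes v :: "'a::euclidean_space"
  shows "orthogonal_transformation (\<lambda>x. x - (2 * (x \<bullet> v) / (v \<bullet> v)) *\<^sub>R v)"
proof (cases "v = 0")
  case True
  then show ?thesis by (simp add: orthogonal_transformation_def linear_iff)
next
  case False
  define k where "k = 2 / (v \<bullet> v)"
  have k: "k * (v \<bullet> v) = 2" using False by (simp add: k_def)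
  have "linear (\<lambda>x. x - (k * (x \<bullet> v)) *\<^sub>R v)"
    by (auto intro!: linearI simp: inner_simps algebra_simps)
  moreover have "(x - (k * (x \<bullet> v)) *\<^sub>R v) \<bullet> (y - (k * (y \<bullet> v)) *\<^sub>R v) = x \<bullet> y" for x y
  proof -
    have "(x - (k * (x \<bullet> v)) *\<^sub>R v) \<bullet> (y - (k * (y \<bullet> v)) *\<^sub>R v)
        = x \<bullet> y + k * (x \<bullet> v) * (y \<bullet> v) * (k * (v \<bullet> v) - 2)"
      using inner_commute[of v x] inner_commute[of v y] by (simp add: inner_simps algebra_simps)
    then show ?thesis using k by simp
  qed
  ultimately show ?thesis
    unfolding orthogonal_transformation_def by (simp add: k_def)
qed

text \<open>
  The reflection in the hyperplane orthogonal to \<open>u\<close> conjugates the shear to its inverse. So both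
  scale volume by the same factor \<open>k\<close>, and \<open>k * k = 1\<close>.
\<close>

lemma lborel_distr_shear:
  fixes u w :: "'a::euclidean_space"
  assumes uw: "u \<bullet> w = 0"
  shows "distr lborel borel (\<lambda>z. z + (z \<bullet> u) *\<^sub>R w) = lborel"
proof (cases "u = 0")
  case True
  then show ?thesis by (simp add: distr_id2)
next
  case False
  define s where "s v z = z + (z \<bullet> u) *\<^sub>R v" for v z :: 'a
  define R where "R x = x - (2 * (x \<bullet> u) / (u \<bullet> u)) *\<^sub>R u" for x
  define c where "c = emeasure (distr lborel borel (s w)) (cball 0 1)"
  let ?b = "emeasure lborel (cball 0 1 :: 'a set)"
  have [measurable]: "s v \<in> borel_measurable borel" for v
    unfolding s_def by measurable
  have [measurable]: "R \<in> borel_measurable borel"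
    unfolding R_def by measurable
  have R: "distr lborel borel R = lborel"
    using lborel_distr_orthogonal_transformation[OF orthogonal_transformation_reflection[of u]]
    by (simp add: R_def[abs_def])
  have lin: "linear (s v)" for v
    unfolding s_def by (auto intro!: linearI simp: algebra_simps inner_simps)
  have inv: "s (-v) (s v z) = z" "s v (s (-v) z) = z" if "u \<bullet> v = 0" for v z
    using that by (simp_all add: s_def inner_simps inner_commute)
  have scale: "emeasure (distr lborel borel (s w)) A * ?b = emeasure lborel A * c"
    if "A \<in> sets borel" for A
    unfolding c_def
  proof (rule translation_invariant_eq_lborel)
    fix n :: nat
    \<comment> \<open>The inverse shear is bounded, so preimages of balls are bounded and the image
      measure is finite on balls.\<close>
    have "norm z \<le> (1 + norm u * norm w) * n" if "norm (s w z) \<le> real n" for z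
    proof -
      have "norm z = norm (s (-w) (s w z))" using inv[OF uw] by simp
      also have "\<dots> \<le> norm (s w z) + \<bar>s w z \<bullet> u\<bar> * norm w"
        unfolding s_def by (metis norm_triangle_ineq norm_scaleR norm_minus_cancel)
      also have "\<dots> \<le> norm (s w z) + (norm (s w z) * norm u) * norm w"
        by (intro add_left_mono mult_right_mono Cauchy_Schwarz_ineq2) auto
      also have "\<dots> = (1 + norm u * norm w) * norm (s w z)" by (simp add: algebra_simps)
      also have "\<dots> \<le> (1 + norm u * norm w) * n" using that by (intro mult_left_mono) auto
      finally show ?thesis .
    qed
    then have "s w -` cball 0 (real n) \<subseteq> cball 0 ((1 + norm u * norm w) * n)" by auto
    then have "emeasure (distr lborel borel (s w)) (cball 0 (real n))
        \<le> emeasure lborel (cball 0 ((1 + norm u * norm w) * n) :: 'a set)"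
      by (auto simp: emeasure_distr intro!: emeasure_mono)
    also have "\<dots> < \<infinity>" by (rule emeasure_lborel_cball_pos_finite)
    finally show "emeasure (distr lborel borel (s w)) (cball 0 (real n)) < \<infinity>" .
  next
    show "distr (distr lborel borel (s w)) borel (\<lambda>x. x + v) = distr lborel borel (s w)" for v
      using distr_linear_translation_invariant[OF lin, of w "s (-w)"] inv[OF uw] by simp
  qed (use that in auto)
  have neg: "distr lborel borel (s (-w)) = distr (distr lborel borel (s w)) borel R"
  proof -
    \<comment> \<open>\<open>R\<close> negates \<open>u\<close> and fixes \<open>w\<close>, so
      conjugation with it changes the sign of the shear.\<close>
    have eq: "R \<circ> s w \<circ> R = s (-w)"
      using False uw by (auto simp: fun_eq_iff R_def s_def inner_simps inner_commute algebra_simps)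
    have "distr lborel borel (R \<circ> s w \<circ> R) = distr (distr lborel borel R) borel (R \<circ> s w)"
      by (subst distr_distr) (auto simp: comp_def)
    also have "\<dots> = distr (distr lborel borel (s w)) borel R"
      by (subst distr_distr) (auto simp: R comp_def)
    finally show ?thesis unfolding eq .
  qed
  have [measurable]: "s (-w) -` cball 0 1 \<in> sets borel"
    using measurable_sets[of "s (-w)" borel borel "cball 0 1"] by simp
  have Rb: "R -` cball 0 1 = cball 0 1"
    using orthogonal_transformation_reflection[of u]
    by (auto simp: orthogonal_transformation R_def)
  have "emeasure lborel (s (-w) -` cball 0 1) = emeasure (distr lborel borel (s (-w))) (cball 0 1)"
    by (simp add: emeasure_distr)
  also have "\<dots> = c"
    unfolding neg by (subst emeasure_distr) (auto simp: Rb c_def)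
  finally have "emeasure lborel (s (-w) -` cball 0 1) = c" .
  moreover have "emeasure (distr lborel borel (s w)) (s (-w) -` cball 0 1) = ?b"
  proof -
    have "s w -` s (-w) -` cball 0 1 = cball 0 1" using inv[OF uw] by auto
    then show ?thesis by (simp add: emeasure_distr)
  qed
  \<comment> \<open>Evaluate \<open>scale\<close> at the preimage of the unit ball under the inverse
    shear: its \<open>lborel\<close> measure is \<open>c\<close>, its image measure under
    \<open>s w\<close> is \<open>?b\<close>.\<close>
  ultimately have "?b * ?b = c * c" using scale[of "s (-w) -` cball 0 1"] by simp
  moreover have fin: "?b \<noteq> 0" "?b \<noteq> top" 
    using emeasure_lborel_cball_pos_finite[where r = 1 and c = "0::'a"] by auto
  ultimately have "c = ?b"
    by (cases c; cases ?b) (auto simp: power2_eq_square[symmetric] ennreal_power ennreal_top_eq_mult_iff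
        power2_eq_iff_nonneg ennreal_mult_eq_top_iff power_eq_top_ennreal)
  show ?thesis
  proof (rule measure_eqI)
    fix A assume "A \<in> sets (distr lborel borel (\<lambda>z. z + (z \<bullet> u) *\<^sub>R w))"
    then have "emeasure (distr lborel borel (s w)) A * ?b = emeasure lborel A * ?b"
      using scale[of A] \<open>c = ?b\<close> by simp
    then show "emeasure (distr lborel borel (\<lambda>z. z + (z \<bullet> u) *\<^sub>R w)) A = emeasure lborel A"
      using fin unfolding s_def by (auto simp: ennreal_mult_cancel_left mult.commute[of _ ?b])
  qed simp
qed

section \<open>Surface measure under isometries\<close>

lemma emeasure_surface_measure:
  "A \<in> sets borel \<Longrightarrow> emeasure surface_measure (A :: 'a::euclidean_space set) = hausdorff_outer (DIM('a) - 1) A"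
  by (simp add: surface_measure_def emeasure_hausdorff_measure)

lemma sets_surface_measure [simp, measurable_cong]: "sets surface_measure = sets borel"
  by (simp add: surface_measure_def)

lemma space_surface_measure [simp]: "space surface_measure = UNIV"
  by (simp add: surface_measure_def)

lemma emeasure_surface_measure_isometry:
  fixes f :: "'a::euclidean_space \<Rightarrow> 'a"
  assumes f: "\<And>x y. dist (f x) (f y) = dist x y" "surj f" and A: "A \<in> sets borel"
  shows "emeasure surface_measure (f -` A) = emeasure surface_measure A"
proof -
  have cont: "continuous_on UNIV f"
    using f(1) by (auto simp: continuous_on_iff)
  then have "f -` A \<in> sets borel"
    using measurable_sets[OF borel_measurable_continuous_onI[OF cont] A] by simp
  moreover have "f ` (f -` A) = A" using f(2) by (rule surj_image_vimage_eq)
  ultimately show ?thesis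
    using hausdorff_outer_isometric_image[of f "DIM('a) - 1" "f -` A"] f(1) A
    by (simp add: emeasure_surface_measure)
qed

text \<open>Reflect in the hyperplane orthogonal to \<open>u - v\<close>; as the norms agree, the
  coefficient of \<open>u - v\<close> at \<open>u\<close> is \<open>1\<close>. For
  \<open>u = v\<close> the map is the identity.\<close>

lemma exists_orthogonal_transformation_unit:
  fixes u v :: "'a::euclidean_space"
  assumes "norm u = 1" "norm v = 1"
  obtains T where "orthogonal_transformation T" "T u = v"
proof
  let ?d = "u - v"
  let ?T = "\<lambda>x. x - (2 * (x \<bullet> ?d) / (?d \<bullet> ?d)) *\<^sub>R ?d"
  show "orthogonal_transformation ?T" by (rule orthogonal_transformation_reflection)
  have "u \<bullet> u = 1" "v \<bullet> v = 1" using assms by (simp_all add: dot_square_norm)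
  then have "?d \<bullet> ?d = 2 * (u \<bullet> ?d)"
    by (simp add: inner_simps inner_commute)
  then show "?T u = v"
    by (cases "u = v") auto
qed

section \<open>Central projection onto a hyperplane\<close>

text \<open>
  The image in the hyperplane \<open>z \<bullet> u = r\<close> is shifted by \<open>r *\<^sub>R u\<close> to the linear subspace
  orthogonal to \<open>u\<close>, where translation invariance makes sense.
\<close>

definition central_projection :: "real \<Rightarrow> 'a::euclidean_space \<Rightarrow> 'a \<Rightarrow> 'a" where
  "central_projection r u z = (r / (z \<bullet> u)) *\<^sub>R z - r *\<^sub>R u"

text \<open>For a unit vector \<open>u\<close> and \<open>r > 0\<close>: the volume of the cone with
  apex \<open>0\<close> over a base in the hyperplane at distance \<open>r\<close>, the base being
  recorded by its translate in the subspace orthogonal to \<open>u\<close>. As a pushforward it is a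
  measure by construction.\<close>

definition cone_measure :: "real \<Rightarrow> 'a::euclidean_space \<Rightarrow> 'a measure" where
  "cone_measure r u =
     distr (density lborel (indicator {z. 0 < z \<bullet> u \<and> z \<bullet> u \<le> r})) borel (central_projection r u)"

lemma central_projection_measurable [measurable]: "central_projection r u \<in> borel_measurable borel"
  unfolding central_projection_def by measurable

lemma sets_cone_measure [simp, measurable_cong]: "sets (cone_measure r u) = sets borel"
  and space_cone_measure [simp]: "space (cone_measure r u) = UNIV"
  by (simp_all add: cone_measure_def)

lemma emeasure_cone_measure:
  assumes [measurable]: "A \<in> sets borel"
  shows "emeasure (cone_measure r u) A
    = emeasure lborel {z. 0 < z \<bullet> u \<and> z \<bullet> u \<le> r \<and> central_projection r u z \<in> A}"
proof -
  have "emeasure (cone_measure r u) A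
      = emeasure lborel ({z. 0 < z \<bullet> u \<and> z \<bullet> u \<le> r} \<inter> central_projection r u -` A)"
    using measurable_sets[OF central_projection_measurable assms, of r u]
    unfolding cone_measure_def by (simp add: emeasure_distr emeasure_density nn_integral_indicator
        indicator_inter_arith[symmetric] measurable_sets_borel)
  also have "{z. 0 < z \<bullet> u \<and> z \<bullet> u \<le> r} \<inter> central_projection r u -` A
      = {z. 0 < z \<bullet> u \<and> z \<bullet> u \<le> r \<and> central_projection r u z \<in> A}" by auto
  finally show ?thesis .
qed

lemma central_projection_orthogonal:
  assumes "norm u = 1" "z \<bullet> u \<noteq> 0"
  shows "central_projection r u z \<bullet> u = 0"
  using assms by (simp add: central_projection_def inner_simps dot_square_norm)

text \<open>The shear fixes \<open>0\<close> and translates the hyperplane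
  \<open>z \<bullet> u = r\<close> by \<open>w\<close>; being linear, it carries rays from
  \<open>0\<close> to rays from \<open>0\<close>.\<close>

lemma central_projection_shear:
  assumes "w \<bullet> u = 0" "r \<noteq> 0" "z \<bullet> u \<noteq> 0"
  shows "central_projection r u (z + (z \<bullet> u) *\<^sub>R (w /\<^sub>R r)) = central_projection r u z + w"
  using assms by (simp add: central_projection_def inner_simps algebra_simps)

lemma central_projection_orthogonal_transformation:
  assumes T: "orthogonal_transformation T"
  shows "central_projection r (T u) (T z) = T (central_projection r u z)"
proof -
  have "linear T" "T z \<bullet> T u = z \<bullet> u" using T by (auto simp: orthogonal_transformation_def)
  then show ?thesis by (simp add: central_projection_def linear_diff linear_cmul)
qed

lemma AE_cone_measure:
  assumes "norm u = 1"
  shows "AE x in cone_measure r u. x \<in> {x. x \<bullet> u = 0}"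
  unfolding cone_measure_def
  by (subst AE_distr_iff) (auto simp: AE_density indicator_def central_projection_orthogonal[OF assms])

text \<open>A point of the cone is stretched by \<open>r / (z \<bullet> u) \<ge> 1\<close> on its
  way to the hyperplane, so the truncated cone over a ball is bounded.\<close>

lemma emeasure_cone_measure_cball_finite:
  assumes "norm u = 1" "r > 0"
  shows "emeasure (cone_measure r u) (cball 0 \<rho>) < \<infinity>"
proof -
  have "norm z \<le> \<rho> + r" if "0 < z \<bullet> u" "z \<bullet> u \<le> r" "norm (central_projection r u z) \<le> \<rho>" for z
  proof -
    have "1 * norm z \<le> (r / (z \<bullet> u)) * norm z"
      using that by (intro mult_right_mono) auto
    then have "norm z \<le> (r / (z \<bullet> u)) * norm z" by simp
    also have "\<dots> = norm (central_projection r u z + r *\<^sub>R u)"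
      using that assms by (simp add: central_projection_def)
    also have "\<dots> \<le> norm (central_projection r u z) + norm (r *\<^sub>R u)" by (rule norm_triangle_ineq)
    also have "\<dots> \<le> \<rho> + r" using that assms by simp
    finally show ?thesis .
  qed
  then have "emeasure (cone_measure r u) (cball 0 \<rho>) \<le> emeasure lborel (cball 0 (\<rho> + r) :: 'a set)"
    by (subst emeasure_cone_measure) (auto intro!: emeasure_mono)
  also have "\<dots> < \<infinity>" by (rule emeasure_lborel_cball_pos_finite)
  finally show ?thesis .
qed

lemma emeasure_cone_measure_cball_pos:
  assumes u: "norm u = 1" and r: "r > 0"
  shows "emeasure (cone_measure r u) (cball 0 1) \<noteq> 0"
proof -
  \<comment> \<open>The ball of radius \<open>e\<close> about \<open>(r / 2) *\<^sub>R u\<close>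
    fits into the cone: \<open>e \<le> r / 4\<close> keeps heights at least \<open>r / 4\<close>, so
    the stretching factor is at most \<open>4\<close>, and \<open>e \<le> 1 / 8\<close> gives
    \<open>4 * (2 * e) \<le> 1\<close>.\<close>
  define e where "e = min (r / 4) (1 / 8)"
  have e: "e > 0" "e \<le> r / 4" "e \<le> 1 / 8" using r by (auto simp: e_def)
  have uu: "u \<bullet> u = 1" using u by (simp add: dot_square_norm)
  have "0 < z \<bullet> u \<and> z \<bullet> u \<le> r \<and> norm (central_projection r u z) \<le> 1"
    if z: "norm (z - (r / 2) *\<^sub>R u) \<le> e" for z
  proof -
    have "\<bar>(z - (r / 2) *\<^sub>R u) \<bullet> u\<bar> \<le> norm (z - (r / 2) *\<^sub>R u) * norm u" by (rule Cauchy_Schwarz_ineq2)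
    then have zu: "\<bar>z \<bullet> u - r / 2\<bar> \<le> e" using z u uu by (simp add: inner_simps)
    then have pos: "z \<bullet> u \<ge> r / 4" "z \<bullet> u \<le> r" using e r by auto
    have "z - (z \<bullet> u) *\<^sub>R u = (z - (r / 2) *\<^sub>R u) + (r / 2 - z \<bullet> u) *\<^sub>R u"
      by (simp add: algebra_simps)
    then have "norm (z - (z \<bullet> u) *\<^sub>R u) \<le> norm (z - (r / 2) *\<^sub>R u) + norm ((r / 2 - z \<bullet> u) *\<^sub>R u)"
      by (metis norm_triangle_ineq)
    then have diff: "norm (z - (z \<bullet> u) *\<^sub>R u) \<le> 2 * e" using z zu u by simp
    have "central_projection r u z = (r / (z \<bullet> u)) *\<^sub>R (z - (z \<bullet> u) *\<^sub>R u)"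
      using pos r by (simp add: central_projection_def algebra_simps)
    then have "norm (central_projection r u z) = (r / (z \<bullet> u)) * norm (z - (z \<bullet> u) *\<^sub>R u)"
      using pos r by simp
    also have "\<dots> \<le> 4 * (2 * e)"
      using diff pos r by (intro mult_mono) (auto simp: field_simps)
    finally show ?thesis using pos r e by auto
  qed
  then have "emeasure lborel (cball ((r / 2) *\<^sub>R u) e) \<le> emeasure (cone_measure r u) (cball 0 1)"
    by (subst emeasure_cone_measure) (auto intro!: emeasure_mono simp: dist_norm norm_minus_commute)
  then show ?thesis
    using emeasure_lborel_cball_pos_finite(1)[OF e(1), of "(r / 2) *\<^sub>R u"] by auto
qed

text \<open>The cone over the translated base is the preimage of the cone over \<open>A\<close>
  under a volume-preserving shear.\<close>

lemma cone_measure_translation: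
  assumes r: "r \<noteq> 0" and w: "w \<bullet> u = 0"
  shows "distr (cone_measure r u) borel (\<lambda>x. x + w) = cone_measure r u"
proof (rule measure_eqI)
  fix A assume "A \<in> sets (distr (cone_measure r u) borel (\<lambda>x. x + w))"
  then have A [measurable]: "A \<in> sets borel" by simp
  have vA [measurable]: "(\<lambda>x. x + w) -` A \<in> sets borel"
    using measurable_sets[of "\<lambda>x. x + w" borel borel A] by simp
  let ?s = "\<lambda>z. z + (z \<bullet> u) *\<^sub>R (w /\<^sub>R r)"
  let ?C = "\<lambda>A. {z. 0 < z \<bullet> u \<and> z \<bullet> u \<le> r \<and> central_projection r u z \<in> A}"
  have su: "?s z \<bullet> u = z \<bullet> u" for z using w by (simp add: inner_simps)
  have [measurable]: "?C A \<in> sets borel" by measurable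
  have "emeasure (distr (cone_measure r u) borel (\<lambda>x. x + w)) A
      = emeasure lborel (?C ((\<lambda>x. x + w) -` A))"
    by (simp add: emeasure_distr emeasure_cone_measure)
  also have "?C ((\<lambda>x. x + w) -` A) = ?s -` ?C A"
    using central_projection_shear[OF w r] su by (auto simp: set_eq_iff)
  also have "emeasure lborel \<dots> = emeasure (distr lborel borel ?s) (?C A)"
    by (subst emeasure_distr) auto
  also have "\<dots> = emeasure lborel (?C A)"
    using w by (subst lborel_distr_shear) (auto simp: inner_commute)
  also have "\<dots> = emeasure (cone_measure r u) A" by (simp add: emeasure_cone_measure)
  finally show "emeasure (distr (cone_measure r u) borel (\<lambda>x. x + w)) A = emeasure (cone_measure r u) A" .
qed simp

text \<open>An orthogonal map taking \<open>u\<close> to \<open>v\<close> carries one cone to the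
  other. With the next lemma, this makes the factor in \<open>surface_measure_hyperplane\<close>
  independent of the normal.\<close>

lemma emeasure_cone_measure_cball_unit:
  fixes u v :: "'a::euclidean_space"
  assumes "norm u = 1" "norm v = 1"
  shows "emeasure (cone_measure r u) (cball 0 \<rho>) = emeasure (cone_measure r v) (cball 0 \<rho>)"
proof -
  obtain T where T: "orthogonal_transformation T" "T u = v"
    using exists_orthogonal_transformation_unit[OF assms] .
  let ?C = "\<lambda>u. {z. 0 < z \<bullet> u \<and> z \<bullet> u \<le> r \<and> norm (central_projection r u z) \<le> \<rho>}"
  have [measurable]: "T \<in> borel_measurable borel"
    using T(1) by (intro borel_measurable_continuous_onI linear_continuous_on)
      (simp add: linear_conv_bounded_linear[symmetric] orthogonal_transformation_def)
  have [measurable]: "?C v \<in> sets borel" by measurable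
  have "T z \<bullet> v = z \<bullet> u" "norm (central_projection r v (T z)) = norm (central_projection r u z)" for z
    using T central_projection_orthogonal_transformation[OF T(1), of r u z]
    by (auto simp: orthogonal_transformation_def orthogonal_transformation_norm)
  then have "?C u = T -` ?C v" by auto
  then have "emeasure lborel (?C u) = emeasure (distr lborel borel T) (?C v)"
    by (subst emeasure_distr) auto
  then show ?thesis
    by (simp add: lborel_distr_orthogonal_transformation[OF T(1)] emeasure_cone_measure)
qed

lemma emeasure_surface_measure_disc_unit:
  fixes u v :: "'a::euclidean_space"
  assumes "norm u = 1" "norm v = 1"
  shows "emeasure surface_measure ({x. x \<bullet> u = 0} \<inter> cball 0 \<rho>)
    = emeasure surface_measure ({x. x \<bullet> v = 0} \<inter> cball 0 \<rho>)"
proof -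
  obtain T where T: "orthogonal_transformation T" "T u = v"
    using exists_orthogonal_transformation_unit[OF assms] .
  have "T z \<bullet> v = z \<bullet> u" "norm (T z) = norm z" for z
    using T by (auto simp: orthogonal_transformation_def orthogonal_transformation_norm)
  then have "T -` ({x. x \<bullet> v = 0} \<inter> cball 0 \<rho>) = {x. x \<bullet> u = 0} \<inter> cball 0 \<rho>" by auto
  moreover have "dist (T x) (T y) = dist x y" for x y
    using T(1) by (metis dist_norm linear_diff orthogonal_transformation)
  moreover have "{x. x \<bullet> v = 0} \<inter> cball 0 \<rho> \<in> sets borel" by measurable
  ultimately show ?thesis
    using emeasure_surface_measure_isometry[of T "{x. x \<bullet> v = 0} \<inter> cball 0 \<rho>"]
      orthogonal_transformation_surj[OF T(1)] by simp
qed

text \<open>Uniqueness of translation-invariant measures on the subspace orthogonal to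
  \<open>u\<close>, normalised on the unit disc. \<open>emeasure_disc_finite\<close> later supplies
  the finiteness on discs.\<close>

lemma surface_measure_hyperplane:
  fixes u :: "'a::euclidean_space"
  assumes u: "norm u = 1" and r: "r > 0"
    and fin: "\<And>n. emeasure surface_measure ({x. x \<bullet> u = 0} \<inter> cball 0 (real n)) < \<infinity>"
    and A [measurable]: "A \<in> sets borel" and AW: "A \<subseteq> {x. x \<bullet> u = 0}"
  shows "emeasure surface_measure A * emeasure (cone_measure r u) (cball 0 1)
    = emeasure (cone_measure r u) A * emeasure surface_measure ({x. x \<bullet> u = 0} \<inter> cball 0 1)"
proof -
  define W where "W = {x. x \<bullet> u = 0}"
  have W [measurable]: "W \<in> sets borel" unfolding W_def by measurable
  have subW: "subspace W" unfolding W_def by (auto simp: subspace_def inner_simps)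
  let ?M = "density surface_measure (indicator W) :: 'a measure"
  have M: "emeasure ?M B = emeasure surface_measure (W \<inter> B)" if "B \<in> sets borel" for B
    using that by (simp add: emeasure_density nn_integral_indicator indicator_inter_arith[symmetric])
  have "emeasure (cone_measure r u) A * emeasure ?M (cball 0 1)
      = emeasure (cone_measure r u) (cball 0 1) * emeasure ?M (uminus -` A)"
  proof (rule translation_invariant_measures_proportional[where W = W])
    show "sigma_finite_measure (cone_measure r u)"
      using emeasure_cone_measure_cball_finite[OF u r] by (intro sigma_finite_measure_cballI) auto
    show "sigma_finite_measure ?M"
      using fin M by (intro sigma_finite_measure_cballI) (auto simp: W_def)
    show "AE x in cone_measure r u. x \<in> W" unfolding W_def by (rule AE_cone_measure[OF u])
    show "AE x in ?M. x \<in> W" by (simp add: AE_density indicator_def)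
    show "distr (cone_measure r u) borel (\<lambda>x. x + w) = cone_measure r u" if "w \<in> W" for w
      using cone_measure_translation[of r w u] that r by (simp add: W_def)
    show "distr ?M borel (\<lambda>x. x + w) = ?M" if w: "w \<in> W" for w
    proof (rule measure_eqI)
      fix B assume "B \<in> sets (distr ?M borel (\<lambda>x. x + w))"
      then have B [measurable]: "B \<in> sets borel" by simp
      have [measurable]: "(\<lambda>x. x + w) -` B \<in> sets borel"
        using measurable_sets[of "\<lambda>x. x + w" borel borel B] by simp
      have "W \<inter> (\<lambda>x. x + w) -` B = (\<lambda>x. x + w) -` (W \<inter> B)"
        using w by (auto simp: W_def inner_simps)
      moreover have "emeasure surface_measure ((\<lambda>x. x + w) -` (W \<inter> B)) = emeasure surface_measure (W \<inter> B)"
        by (rule emeasure_surface_measure_isometry) (auto simp: surj_plus_right)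
      ultimately show "emeasure (distr ?M borel (\<lambda>x. x + w)) B = emeasure ?M B"
        by (simp add: emeasure_distr M)
    qed simp
  qed (use subW in auto)
  \<comment> \<open>Negation is an isometry preserving \<open>W\<close>, which removes the
    reflection that the uniqueness lemma leaves.\<close>
  moreover have "emeasure ?M (uminus -` A) = emeasure surface_measure A"
  proof -
    have [measurable]: "uminus -` A \<in> sets borel"
      using measurable_sets[of uminus borel borel A] by simp
    have "W \<inter> uminus -` A = uminus -` A" using AW by (auto simp: W_def)
    moreover have "emeasure surface_measure (uminus -` A) = emeasure surface_measure A"
      by (rule emeasure_surface_measure_isometry) (auto simp: dist_minus surj_def intro: exI[of _ "- _"])
    ultimately show ?thesis by (simp add: M)
  qed
  ultimately show ?thesis by (simp add: M mult.commute flip: W_def)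
qed

section \<open>Distortion of distances by central projection\<close>

lemma central_projection_diff:
  assumes "x \<bullet> u \<noteq> 0" "y \<bullet> u \<noteq> 0"
  shows "central_projection r u x - central_projection r u y
    = (r / (x \<bullet> u)) *\<^sub>R ((x - y) + (((y - x) \<bullet> u) / (y \<bullet> u)) *\<^sub>R y)"
proof -
  have "r / (x \<bullet> u) * (((y - x) \<bullet> u) / (y \<bullet> u)) = r / (x \<bullet> u) - r / (y \<bullet> u)"
    using assms by (simp add: inner_simps field_simps)
  then show ?thesis
    by (simp add: central_projection_def scaleR_add_right scaleR_diff_right scaleR_diff_left)
qed

text \<open>\<open>\<eta>\<close> bounds the slope of the segment from \<open>x\<close> to
  \<open>y\<close> against the hyperplane. The projection scales \<open>x - y + v\<close> by
  \<open>r / (x \<bullet> u)\<close>, where \<open>v\<close> comes from the height difference and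
  has norm at most \<open>\<eta> * R / a * dist x y\<close>. The lower bound uses that the scaling
  factor is at least \<open>1\<close> for \<open>x \<bullet> u \<le> r\<close>.\<close>

lemma central_projection_bilipschitz:
  fixes x y u :: "'a::euclidean_space"
  assumes a: "0 < a" "a \<le> x \<bullet> u" "a \<le> y \<bullet> u" and r: "0 < r" and R: "norm y \<le> R"
    and \<eta>: "0 \<le> \<eta>" "\<bar>(y - x) \<bullet> u\<bar> \<le> \<eta> * dist x y"
  shows "dist (central_projection r u x) (central_projection r u y)
      \<le> r / a * (1 + \<eta> * R / a) * dist x y" (is ?upper)
    and "x \<bullet> u \<le> r \<Longrightarrow> (1 - \<eta> * R / a) * dist x y
      \<le> dist (central_projection r u x) (central_projection r u y)" (is "_ \<Longrightarrow> ?lower")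
proof -
  define v where "v = (((y - x) \<bullet> u) / (y \<bullet> u)) *\<^sub>R y"
  have "norm v = \<bar>(y - x) \<bullet> u\<bar> * norm y / (y \<bullet> u)" using a by (simp add: v_def)
  also have "\<dots> \<le> (\<eta> * dist x y) * R / a"
    using a R \<eta> order_trans[OF norm_ge_zero R] by (intro frac_le mult_mono mult_nonneg_nonneg) auto
  finally have v: "norm v \<le> \<eta> * R / a * dist x y" by (simp add: mult_ac)
  have eq: "dist (central_projection r u x) (central_projection r u y) = r / (x \<bullet> u) * norm ((x - y) + v)"
    using a r by (simp add: dist_norm central_projection_diff v_def)
  have "norm ((x - y) + v) \<le> (1 + \<eta> * R / a) * dist x y"
    using norm_triangle_ineq[of "x - y" v] v by (simp add: dist_norm algebra_simps)
  then have "r / (x \<bullet> u) * norm ((x - y) + v) \<le> r / a * ((1 + \<eta> * R / a) * dist x y)"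
    using a r by (intro mult_mono divide_left_mono) auto
  then show ?upper by (simp add: eq mult.assoc)
  show ?lower if "x \<bullet> u \<le> r"
  proof -
    have "(1 - \<eta> * R / a) * dist x y \<le> 1 * norm ((x - y) + v)"
      using norm_diff_ineq[of "x - y" v] v by (simp add: dist_norm algebra_simps)
    also have "\<dots> \<le> r / (x \<bullet> u) * norm ((x - y) + v)"
      using a that by (intro mult_right_mono) auto
    finally show ?thesis by (simp add: eq)
  qed
qed

section \<open>Radial projection onto the boundary\<close>

locale body_with_ball =
  fixes K :: "'a::euclidean_space set" and c :: 'a and r :: real
  assumes body: "convex_body K" and r_pos: "r > 0" and ball_subset: "cball c r \<subseteq> K"
begin

lemma convex: "convex K" and compact: "compact K"
  using body by (auto simp: convex_body_def)

lemma bounded: "bounded K" and closed: "closed K"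
  using compact by (auto simp: compact_imp_bounded compact_imp_closed)

lemma subset_cball:
  obtains R where "0 < R" "K \<subseteq> cball c R"
proof -
  obtain e where "\<forall>y\<in>K. dist c y \<le> e" using bounded bounded_any_center by blast
  then have "K \<subseteq> cball c (max e 1)" by force
  then show ?thesis using that[of "max e 1"] by simp
qed

lemma frontier_subset: "frontier K \<subseteq> K"
  using closed by (rule frontier_subset_closed)

lemma ball_subset_interior: "ball c r \<subseteq> interior K"
  using ball_subset by (intro interior_maximal) auto

lemma centre_in_interior: "c \<in> interior K"
  using ball_subset_interior r_pos by auto

lemma frontier_norm_ge: "y \<in> frontier K \<Longrightarrow> r \<le> norm (y - c)"
  using ball_subset_interior by (force simp: frontier_def dist_norm norm_minus_commute)

abbreviation proj :: "'a \<Rightarrow> 'a" where "proj \<equiv> radial_projection K c"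

lemma proj_unique:
  assumes "y \<in> frontier K" "y = c + t *\<^sub>R (z - c)" "0 \<le> t"
  shows "proj z = y"
proof -
  have "z \<noteq> c" using assms frontier_norm_ge[of y] r_pos by auto
  from radial_projection_ex1[OF convex bounded centre_in_interior this] show ?thesis
    unfolding radial_projection_def using assms by (intro the1_equality) blast+
qed

lemma projE:
  assumes "z \<noteq> c"
  obtains t where "0 < t" "proj z = c + t *\<^sub>R (z - c)" "proj z \<in> frontier K"
proof -
  from theI'[OF radial_projection_ex1[OF convex bounded centre_in_interior assms]]
  obtain t where t: "0 \<le> t" "proj z = c + t *\<^sub>R (z - c)" "proj z \<in> frontier K"
    unfolding radial_projection_def by blast
  moreover have "t \<noteq> 0" using t frontier_norm_ge[of "proj z"] r_pos by auto
  ultimately show ?thesis using that[of t] by simp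
qed

lemma proj_scale:
  assumes "0 < s" shows "proj (c + s *\<^sub>R z) = proj (c + z)"
proof (cases "z = 0")
  case False
  then obtain t where t: "0 < t" "proj (c + z) = c + t *\<^sub>R z" "proj (c + z) \<in> frontier K"
    using projE[of "c + z"] by (auto simp: add_diff_cancel_left')
  have "c + t *\<^sub>R z = c + (t / s) *\<^sub>R ((c + s *\<^sub>R z) - c)" using assms by simp
  from proj_unique[OF _ this] show ?thesis using t assms by simp
qed simp

text \<open>Points strictly between the interior point \<open>c\<close> and a point of the closure
  are interior, so the ray is interior before the boundary parameter \<open>d\<close> and has left
  \<open>K\<close> after it.\<close>

lemma ray_interior_iff:
  assumes "proj (c + z) = c + d *\<^sub>R z" "proj (c + z) \<in> frontier K" "0 < d" "0 \<le> t"
  shows "c + t *\<^sub>R z \<in> interior K \<longleftrightarrow> t < d"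
    and "c + t *\<^sub>R z \<in> K \<longleftrightarrow> t \<le> d"
proof -
  have shrink: "c + s *\<^sub>R z \<in> interior K" if "c + t *\<^sub>R z \<in> closure K" "0 \<le> s" "s < t" for s t
  proof -
    have "(c + t *\<^sub>R z) - (1 - s / t) *\<^sub>R ((c + t *\<^sub>R z) - c) \<in> interior K"
      using that by (intro mem_interior_closure_convex_shrink[OF convex centre_in_interior]) auto
    then show ?thesis using that by (simp add: algebra_simps)
  qed
  have d: "c + d *\<^sub>R z \<in> closure K" "c + d *\<^sub>R z \<notin> interior K"
    using assms by (auto simp: frontier_def)
  have K: "closure K = K" using closed by simp
  show "c + t *\<^sub>R z \<in> interior K \<longleftrightarrow> t < d"
    using shrink[OF d(1), of t] shrink[of t d] d assms interior_subset[of K] K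
    by (metis less_eq_real_def not_less_iff_gr_or_eq subsetD)
  show "c + t *\<^sub>R z \<in> K \<longleftrightarrow> t \<le> d"
    using shrink[OF d(1), of t] shrink[of t d] d assms interior_subset[of K] K
    by (metis less_eq_real_def not_less_iff_gr_or_eq subsetD)
qed

text \<open>The stretching factor \<open>d z\<close> exceeds \<open>a \<ge> 0\<close> exactly if
  \<open>z \<noteq> c\<close> and the point with parameter \<open>a\<close> on the ray is still
  interior, an open condition. The unspecified value at \<open>c\<close> is handled by a case split
  on a singleton.\<close>

lemma proj_measurable [measurable]: "proj \<in> borel_measurable borel"
proof -
  define d where "d z = (if z = c then 0 else norm (proj z - c) / norm (z - c))" for z
  have d: "0 < d z" "proj z = c + d z *\<^sub>R (z - c)" "proj z \<in> frontier K" if "z \<noteq> c" for z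
  proof -
    from projE[OF that] obtain t where t: "0 < t" "proj z = c + t *\<^sub>R (z - c)" "proj z \<in> frontier K" .
    then have "d z = t" using that by (simp add: d_def)
    then show "0 < d z" "proj z = c + d z *\<^sub>R (z - c)" "proj z \<in> frontier K" using t by auto
  qed
  have "{z. a < d z} \<in> sets borel" for a
  proof (cases "a < 0")
    case True
    then have "a < d z" for z using d(1)[of z] by (cases "z = c") (auto simp: d_def)
    then have "{z. a < d z} = UNIV" by auto
    then show ?thesis by simp
  next
    case False
    have "a < d z \<longleftrightarrow> z \<noteq> c \<and> c + a *\<^sub>R (z - c) \<in> interior K" for z
    proof (cases "z = c")
      case True
      then show ?thesis using False by (simp add: d_def)
    next
      case ne: False
      have "c + (z - c) = z" by simp
      then show ?thesis
        using ray_interior_iff(1)[of "z - c" "d z" a, unfolded \<open>c + (z - c) = z\<close>, OF d(2,3,1)] ne False by simp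
    qed
    then have "{z. a < d z} = - {c} \<inter> (\<lambda>z. c + a *\<^sub>R (z - c)) -` interior K" by auto
    moreover have "open ((\<lambda>z. c + a *\<^sub>R (z - c)) -` interior K)"
      by (intro open_vimage) (auto intro!: continuous_intros)
    ultimately show ?thesis by auto
  qed
  then have [measurable]: "d \<in> borel_measurable borel"
    by (simp add: borel_measurable_iff_greater)
  have "proj = (\<lambda>z. if z = c then proj c else c + d z *\<^sub>R (z - c))" using d(2) by auto
  also have "\<dots> \<in> borel_measurable borel" by measurable
  finally show ?thesis .
qed

text \<open>The projective distribution before normalisation. Whether the apex is counted depends on
  the unspecified \<open>proj c\<close>, which affects only a single point.\<close>

definition cone_volume :: "'a set \<Rightarrow> ennreal" where
  "cone_volume A = emeasure lborel (K \<inter> proj -` A)"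

text \<open>Written as a preimage, it is Borel for Borel \<open>A\<close>;
  \<open>slice_eq_image\<close> identifies it with the centrally projected image if \<open>A\<close>
  is a part of the boundary at positive heights.\<close>

definition slice :: "real \<Rightarrow> 'a \<Rightarrow> 'a set \<Rightarrow> 'a set" where
  "slice \<rho> u A = {w. w \<bullet> u = 0 \<and> proj (c + (\<rho> *\<^sub>R u + w)) \<in> A}"

lemma K_measurable [measurable]: "K \<in> sets borel" and frontier_measurable [measurable]: "frontier K \<in> sets borel"
  using closed by (auto intro: borel_closed)

lemma proj_vimage_measurable: "A \<in> sets borel \<Longrightarrow> proj -` A \<in> sets borel"
  using measurable_sets[OF proj_measurable] by simp

lemma slice_measurable [measurable]:
  assumes [measurable]: "A \<in> sets borel"
  shows "slice \<rho> u A \<in> sets borel"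
  unfolding slice_def by measurable

lemma slice_eq_image:
  assumes u: "norm u = 1" and "0 < \<rho>" and A: "A \<subseteq> frontier K" "\<And>y. y \<in> A \<Longrightarrow> 0 < (y - c) \<bullet> u"
  shows "slice \<rho> u A = (\<lambda>y. central_projection \<rho> u (y - c)) ` A"
proof (intro equalityI subsetI)
  have uu: "u \<bullet> u = 1" using u by (simp add: dot_square_norm)
  fix w assume "w \<in> slice \<rho> u A"
  then have w: "w \<bullet> u = 0" "proj (c + (\<rho> *\<^sub>R u + w)) \<in> A" by (auto simp: slice_def)
  have "(\<rho> *\<^sub>R u + w) \<bullet> u = \<rho>" using w uu by (simp add: inner_simps)
  then have "c + (\<rho> *\<^sub>R u + w) \<noteq> c" using assms by auto
  from projE[OF this] obtain t where t: "0 < t" "proj (c + (\<rho> *\<^sub>R u + w)) = c + t *\<^sub>R (\<rho> *\<^sub>R u + w)"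
    by auto
  then have "central_projection \<rho> u (proj (c + (\<rho> *\<^sub>R u + w)) - c) = w"
    using w uu \<open>0 < \<rho>\<close> by (simp add: central_projection_def inner_simps)
  then show "w \<in> (\<lambda>y. central_projection \<rho> u (y - c)) ` A" using w by force
next
  fix w assume "w \<in> (\<lambda>y. central_projection \<rho> u (y - c)) ` A"
  then obtain y where y: "y \<in> A" "w = central_projection \<rho> u (y - c)" by auto
  let ?t = "\<rho> / ((y - c) \<bullet> u)"
  have t: "0 < ?t" using A(2)[OF y(1)] \<open>0 < \<rho>\<close> by simp
  have "c + (\<rho> *\<^sub>R u + w) = c + ?t *\<^sub>R (y - c)" by (simp add: y central_projection_def)
  then have "proj (c + (\<rho> *\<^sub>R u + w)) = proj (c + (y - c))" using proj_scale[OF t] by simp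
  also have "\<dots> = y" using y A by (intro proj_unique[where t = 1]) auto
  finally show "w \<in> slice \<rho> u A"
    using y A(2)[OF y(1)] central_projection_orthogonal[OF u, of "y - c"] by (auto simp: slice_def)
qed

lemma cone_measure_slice:
  assumes u: "norm u = 1" and A: "A \<in> sets borel"
  shows "emeasure (cone_measure \<rho> u) (slice \<rho> u A)
    = emeasure lborel {z. 0 < z \<bullet> u \<and> z \<bullet> u \<le> \<rho> \<and> proj (c + z) \<in> A}"
proof -
  have "proj (c + (\<rho> *\<^sub>R u + central_projection \<rho> u z)) = proj (c + z)" if "0 < z \<bullet> u" "z \<bullet> u \<le> \<rho>" for z
    using proj_scale[of "\<rho> / (z \<bullet> u)" z] that by (simp add: central_projection_def)
  then have "{z. 0 < z \<bullet> u \<and> z \<bullet> u \<le> \<rho> \<and> central_projection \<rho> u z \<in> slice \<rho> u A}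
      = {z. 0 < z \<bullet> u \<and> z \<bullet> u \<le> \<rho> \<and> proj (c + z) \<in> A}"
    using central_projection_orthogonal[OF u] by (auto simp: slice_def)
  then show ?thesis using A by (simp add: emeasure_cone_measure)
qed

text \<open>A point \<open>z \<noteq> c\<close> of \<open>K\<close> does not lie beyond
  \<open>proj z\<close> on its ray, so its height is at most that of \<open>proj z\<close>, hence at
  most \<open>\<rho>\<close>.\<close>

lemma cone_volume_le_cone_measure:
  assumes u: "norm u = 1" and A [measurable]: "A \<in> sets borel"
    and Au: "\<And>y. y \<in> A \<Longrightarrow> 0 < (y - c) \<bullet> u \<and> (y - c) \<bullet> u \<le> \<rho>"
  shows "cone_volume A \<le> emeasure (cone_measure \<rho> u) (slice \<rho> u A)"
proof -
  let ?E = "{z. 0 < z \<bullet> u \<and> z \<bullet> u \<le> \<rho> \<and> proj (c + z) \<in> A}"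
  have [measurable]: "?E \<in> sets borel" by measurable
  \<comment> \<open>The apex may belong to the left-hand side but has height \<open>0\<close>, so it
    is added separately.\<close>
  have "K \<inter> proj -` A \<subseteq> (\<lambda>x. x + (-c)) -` ?E \<union> {c}"
  proof (intro subsetI UnCI)
    fix z assume z: "z \<in> K \<inter> proj -` A" "z \<notin> {c}"
    then obtain d where d: "0 < d" "proj z = c + d *\<^sub>R (z - c)" "proj z \<in> frontier K"
      using projE[of z] by auto
    then have "1 \<le> d" using ray_interior_iff(2)[of "z - c" d 1] z by simp
    have pz: "0 < (proj z - c) \<bullet> u" "(proj z - c) \<bullet> u \<le> \<rho>" using Au[of "proj z"] z by auto
    have eq: "(proj z - c) \<bullet> u = d * ((z - c) \<bullet> u)" using d by simp
    then have "0 < (z - c) \<bullet> u" using pz d(1) by (simp add: zero_less_mult_iff)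
    moreover have "1 * ((z - c) \<bullet> u) \<le> d * ((z - c) \<bullet> u)"
      using \<open>1 \<le> d\<close> \<open>0 < (z - c) \<bullet> u\<close> by (intro mult_right_mono) auto
    then have "(z - c) \<bullet> u \<le> \<rho>" using pz(2) unfolding eq by linarith
    ultimately show "z \<in> (\<lambda>x. x + (-c)) -` ?E" using z by (simp add: inner_diff_left)
  qed
  then have "cone_volume A \<le> emeasure lborel ((\<lambda>x. x + (-c)) -` ?E \<union> {c})"
    unfolding cone_volume_def
    by (intro emeasure_mono) (auto intro!: sets.Un measurable_sets_borel[of _ borel] )
  also have "\<dots> \<le> emeasure lborel ((\<lambda>x. x + (-c)) -` ?E) + emeasure lborel {c}"
    by (intro emeasure_subadditive) (auto intro!: measurable_sets_borel[of _ borel])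
  also have "emeasure lborel ((\<lambda>x. x + (-c)) -` ?E) = emeasure (distr lborel borel (\<lambda>x. x + (-c))) ?E"
    by (subst emeasure_distr) auto
  also have "\<dots> = emeasure (cone_measure \<rho> u) (slice \<rho> u A)"
    unfolding lborel_distr_translation cone_measure_slice[OF u A] ..
  finally show ?thesis by simp
qed

text \<open>Dilation by \<open>a / \<rho>\<close> about the apex takes the cone truncated at height
  \<open>\<rho>\<close> into \<open>K\<close>, because the boundary points in \<open>A\<close> have
  height at least \<open>a\<close>.\<close>

lemma cone_measure_le_cone_volume:
  assumes u: "norm u = 1" and A [measurable]: "A \<in> sets borel" and a: "0 < a" "0 < \<rho>"
    and Au: "\<And>y. y \<in> A \<Longrightarrow> a \<le> (y - c) \<bullet> u"
  shows "ennreal ((a / \<rho>) ^ DIM('a)) * emeasure (cone_measure \<rho> u) (slice \<rho> u A) \<le> cone_volume A"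
proof -
  let ?E = "{z. 0 < z \<bullet> u \<and> z \<bullet> u \<le> \<rho> \<and> proj (c + z) \<in> A}"
  let ?s = "a / \<rho>"
  have s: "0 < ?s" using a by simp
  have V: "K \<inter> proj -` A \<in> sets borel" using proj_vimage_measurable[OF A] by auto
  have "c + ?s *\<^sub>R z \<in> K \<inter> proj -` A" if "z \<in> ?E" for z
  proof -
    from that have "c + z \<noteq> c" by auto
    from projE[OF this] obtain d where d: "0 < d" "proj (c + z) = c + d *\<^sub>R z" "proj (c + z) \<in> frontier K"
      by auto
    have "a \<le> d * (z \<bullet> u)" using Au[of "proj (c + z)"] that d by simp
    also have "\<dots> \<le> d * \<rho>" using d that by (intro mult_left_mono) auto
    finally have "?s \<le> d" using a by (simp add: field_simps)
    then have "c + ?s *\<^sub>R z \<in> K" using ray_interior_iff(2)[OF d(2,3,1)] s by simp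
    moreover have "proj (c + ?s *\<^sub>R z) = proj (c + z)" using s by (rule proj_scale)
    ultimately show ?thesis using that by auto
  qed
  then have "emeasure lborel ?E \<le> emeasure lborel ((\<lambda>z. c + ?s *\<^sub>R z) -` (K \<inter> proj -` A))"
    using V by (intro emeasure_mono) (auto intro!: measurable_sets_borel[of _ borel])
  also have "ennreal (?s ^ DIM('a)) * \<dots> = cone_volume A"
    using V s arg_cong[OF lborel_affine[of ?s c], of "\<lambda>M. emeasure M (K \<inter> proj -` A)"] a
    unfolding cone_volume_def
    by (simp add: emeasure_density emeasure_distr nn_integral_cmult_indicator)
  finally show ?thesis
    using cone_measure_slice[OF u A, of \<rho>] by (simp add: mult_left_mono)
qed

section \<open>Surface measure of slices and of discs\<close>

lemma emeasure_slice_le: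
  assumes u: "norm u = 1" and \<rho>: "0 < \<rho>" and L: "0 < L"
    and A: "A \<in> sets borel" "A \<subseteq> frontier K" "\<And>y. y \<in> A \<Longrightarrow> 0 < (y - c) \<bullet> u"
    and lip: "\<And>x y. x \<in> A \<Longrightarrow> y \<in> A \<Longrightarrow>
      dist (central_projection \<rho> u (x - c)) (central_projection \<rho> u (y - c)) \<le> L * dist x y"
  shows "emeasure surface_measure (slice \<rho> u A) \<le> ennreal (L ^ (DIM('a) - 1)) * emeasure surface_measure A"
  using hausdorff_outer_lipschitz_image[OF L lip, of A "DIM('a) - 1"] A
  by (simp add: emeasure_surface_measure slice_eq_image[OF u \<rho> A(2,3)] flip: slice_eq_image[OF u \<rho> A(2,3)])

text \<open>The assumed bound makes the projection injective on \<open>A\<close> with a Lipschitz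
  inverse.\<close>

lemma emeasure_le_slice:
  assumes u: "norm u = 1" and \<rho>: "0 < \<rho>" and L: "0 < L"
    and A: "A \<in> sets borel" "A \<subseteq> frontier K" "\<And>y. y \<in> A \<Longrightarrow> 0 < (y - c) \<bullet> u"
    and lip: "\<And>x y. x \<in> A \<Longrightarrow> y \<in> A \<Longrightarrow>
      dist x y \<le> L * dist (central_projection \<rho> u (x - c)) (central_projection \<rho> u (y - c))"
  shows "emeasure surface_measure A \<le> ennreal (L ^ (DIM('a) - 1)) * emeasure surface_measure (slice \<rho> u A)"
proof -
  let ?\<phi> = "\<lambda>y. central_projection \<rho> u (y - c)"
  have inj: "inj_on ?\<phi> A"
  proof (rule inj_onI)
    fix x y assume "x \<in> A" "y \<in> A" "?\<phi> x = ?\<phi> y"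
    then show "x = y" using lip[of x y] by simp
  qed
  have "dist (inv_into A ?\<phi> x) (inv_into A ?\<phi> y) \<le> L * dist x y" if "x \<in> ?\<phi> ` A" "y \<in> ?\<phi> ` A" for x y
    using lip[of "inv_into A ?\<phi> x" "inv_into A ?\<phi> y"] that
    by (simp add: inv_into_into f_inv_into_f[where f = ?\<phi>])
  from hausdorff_outer_lipschitz_image[OF L this, where n = "DIM('a) - 1" and A = "?\<phi> ` A"]
  have "hausdorff_outer (DIM('a) - 1) (inv_into A ?\<phi> ` ?\<phi> ` A)
      \<le> ennreal (L ^ (DIM('a) - 1)) * hausdorff_outer (DIM('a) - 1) (?\<phi> ` A)" by blast
  also have "inv_into A ?\<phi> ` ?\<phi> ` A = A"
    using inj by (simp add: inv_into_image_cancel)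
  finally show ?thesis
    using A by (simp add: emeasure_surface_measure slice_eq_image[OF u \<rho> A(2,3), symmetric])
qed

text \<open>By Cauchy-Schwarz the slope bound \<open>\<eta> = 1\<close> holds for all pairs of
  points, which gives one crude constant for all boundary parts at height at least
  \<open>a\<close>.\<close>

lemma slice_lipschitz_constant:
  assumes u: "norm u = 1" and "0 < a" "0 < \<rho>"
  obtains L where "0 < L"
    "\<And>A. A \<in> sets borel \<Longrightarrow> A \<subseteq> frontier K \<Longrightarrow> (\<And>y. y \<in> A \<Longrightarrow> a \<le> (y - c) \<bullet> u) \<Longrightarrow>
      emeasure surface_measure (slice \<rho> u A) \<le> ennreal L * emeasure surface_measure A"
proof -
  obtain R where R: "0 < R" "K \<subseteq> cball c R"
    using subset_cball .
  define L where "L = \<rho> / a * (1 + 1 * R / a)"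
  have "0 < 1 + 1 * R / a" using R assms by (intro add_pos_pos) auto
  then have L: "0 < L" using assms by (simp add: L_def)
  show ?thesis
  proof (rule that[of "L ^ (DIM('a) - 1)"])
    fix A assume A: "A \<in> sets borel" "A \<subseteq> frontier K" "\<And>y. y \<in> A \<Longrightarrow> a \<le> (y - c) \<bullet> u"
    show "emeasure surface_measure (slice \<rho> u A) \<le> ennreal (L ^ (DIM('a) - 1)) * emeasure surface_measure A"
    proof (rule emeasure_slice_le[OF u \<open>0 < \<rho>\<close> L A(1,2)])
      show "0 < (y - c) \<bullet> u" if "y \<in> A" for y using A(3)[OF that] \<open>0 < a\<close> by linarith
      fix x y assume xy: "x \<in> A" "y \<in> A"
      have "\<bar>(y - c - (x - c)) \<bullet> u\<bar> \<le> 1 * dist (x - c) (y - c)"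
        using Cauchy_Schwarz_ineq2[of "y - x" u] u by (simp add: dist_norm norm_minus_commute)
      moreover have "norm (y - c) \<le> R"
        using xy A(2) frontier_subset R(2) by (force simp: dist_norm norm_minus_commute)
      ultimately have "dist (central_projection \<rho> u (x - c)) (central_projection \<rho> u (y - c))
          \<le> L * dist (x - c) (y - c)"
        unfolding L_def using A(3) xy assms by (intro central_projection_bilipschitz(1)) auto
      then show "dist (central_projection \<rho> u (x - c)) (central_projection \<rho> u (y - c)) \<le> L * dist x y"
        by (simp add: dist_norm)
    qed
  qed (use L in simp)
qed

text \<open>The disc lies in a Lipschitz image of a part of the boundary, which has finite
  measure.\<close>

lemma emeasure_disc_finite:
  fixes u :: 'a
  assumes u: "norm u = 1" and fin: "emeasure surface_measure (frontier K) < \<infinity>"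
  shows "emeasure surface_measure ({x. x \<bullet> u = 0} \<inter> cball 0 (real n)) < \<infinity>"
proof -
  \<comment> \<open>For \<open>norm w \<le> n\<close> the ray along \<open>r *\<^sub>R u + w\<close>
    meets the boundary at a parameter \<open>t \<ge> r / (r + n)\<close>, since boundary points have
    distance at least \<open>r\<close> from \<open>c\<close>; the height there is
    \<open>t * r \<ge> a\<close>.\<close>
  define a where "a = r * r / (r + n)"
  have a: "0 < a" using r_pos by (auto simp: a_def intro!: divide_pos_pos add_pos_nonneg)
  define A where "A = frontier K \<inter> {y. a \<le> (y - c) \<bullet> u}"
  have A [measurable]: "A \<in> sets borel" unfolding A_def by measurable
  obtain L where L: "emeasure surface_measure (slice r u A) \<le> ennreal L * emeasure surface_measure A"
  proof (rule slice_lipschitz_constant[OF u a r_pos])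
    fix L assume *: "\<And>A. A \<in> sets borel \<Longrightarrow> A \<subseteq> frontier K \<Longrightarrow> (\<And>y. y \<in> A \<Longrightarrow> a \<le> (y - c) \<bullet> u) \<Longrightarrow>
      emeasure surface_measure (slice r u A) \<le> ennreal L * emeasure surface_measure A"
    show thesis by (rule that, rule *) (auto simp: A_def)
  qed
  have "w \<in> slice r u A" if w: "w \<bullet> u = 0" "norm w \<le> n" for w
  proof -
    have wu: "(r *\<^sub>R u + w) \<bullet> u = r" using w u by (simp add: inner_simps dot_square_norm)
    then have "c + (r *\<^sub>R u + w) \<noteq> c" using r_pos by auto
    from projE[OF this] obtain t where t: "0 < t" "proj (c + (r *\<^sub>R u + w)) = c + t *\<^sub>R (r *\<^sub>R u + w)"
        "proj (c + (r *\<^sub>R u + w)) \<in> frontier K" by auto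
    have "r \<le> t * norm (r *\<^sub>R u + w)" using frontier_norm_ge[OF t(3)] t by simp
    also have "\<dots> \<le> t * (r + n)"
      using t w u r_pos norm_triangle_ineq[of "r *\<^sub>R u" w] by (intro mult_left_mono) auto
    finally have "r / (r + n) \<le> t" using r_pos by (simp add: pos_divide_le_eq add_pos_nonneg)
    then have "a \<le> t * r" using mult_right_mono[of "r / (r + n)" t r] r_pos by (simp add: a_def)
    also have "\<dots> = (proj (c + (r *\<^sub>R u + w)) - c) \<bullet> u" using t(2) wu by simp
    finally show ?thesis using t w by (simp add: slice_def A_def)
  qed
  then have "emeasure surface_measure ({x. x \<bullet> u = 0} \<inter> cball 0 (real n)) \<le> emeasure surface_measure (slice r u A)"
    by (intro emeasure_mono) auto
  also have "\<dots> \<le> ennreal L * emeasure surface_measure (frontier K)"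
    using L by (rule order_trans) (auto simp: A_def intro!: mult_left_mono emeasure_mono)
  also have "\<dots> < \<infinity>" using fin by (simp add: ennreal_mult_less_top)
  finally show ?thesis .
qed

text \<open>Cover \<open>N\<close> by finitely many parts, each at height bounded below in a signed
  basis direction. Each projects to a surface-null subset of a hyperplane, and \<open>pos\<close>
  allows the factor to be cancelled, so that the subset is also null for the cone measure.\<close>

lemma cone_volume_null:
  assumes N: "N \<in> sets borel" "N \<subseteq> frontier K" "emeasure surface_measure N = 0"
    and fin: "emeasure surface_measure (frontier K) < \<infinity>"
    and pos: "\<And>u::'a. norm u = 1 \<Longrightarrow> emeasure surface_measure ({x. x \<bullet> u = 0} \<inter> cball 0 1) \<noteq> 0"
  shows "cone_volume N = 0"
proof -
  obtain R where R: "0 < R" "K \<subseteq> cball c R"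
    using subset_cball .
  \<comment> \<open>If all coordinates of \<open>y - c\<close> were smaller than \<open>a\<close> in
    absolute value, its norm would be below \<open>r\<close>.\<close>
  define a where "a = r / DIM('a)"
  have a: "0 < a" using r_pos by (simp add: a_def)
  define U where "U = Basis \<union> uminus ` (Basis :: 'a set)"
  have U: "norm u = 1" if "u \<in> U" for u using that by (auto simp: U_def)
  define A where "A u = N \<inter> {y. a \<le> (y - c) \<bullet> u}" for u
  have A [measurable]: "A u \<in> sets borel" for u using N(1) unfolding A_def by measurable
  have "cone_volume (A u) = 0" if "u \<in> U" for u
  proof -
    note u = U[OF that]
    have AN: "A u \<subseteq> frontier K" "emeasure surface_measure (A u) = 0"
      using N emeasure_mono[of "A u" N surface_measure] by (auto simp: A_def)
    \<comment> \<open>The hyperplane is taken at distance \<open>R\<close>, because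
      \<open>cone_volume_le_cone_measure\<close> asks for heights at most that distance.\<close>
    obtain L where
      "emeasure surface_measure (slice R u (A u)) \<le> ennreal L * emeasure surface_measure (A u)"
    proof (rule slice_lipschitz_constant[OF u a R(1)])
      fix L assume *: "\<And>A. A \<in> sets borel \<Longrightarrow> A \<subseteq> frontier K \<Longrightarrow> (\<And>y. y \<in> A \<Longrightarrow> a \<le> (y - c) \<bullet> u) \<Longrightarrow>
        emeasure surface_measure (slice R u A) \<le> ennreal L * emeasure surface_measure A"
      show thesis by (rule that, rule *) (use AN A[of u] in \<open>auto simp: A_def\<close>)
    qed
    then have "emeasure surface_measure (slice R u (A u)) = 0" using AN by simp
    then have "emeasure (cone_measure R u) (slice R u (A u)) = 0"
      using surface_measure_hyperplane[OF u R(1) emeasure_disc_finite[OF u fin], of "slice R u (A u)"]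
        pos[OF u] A by (auto simp: slice_def)
    moreover have "0 < (y - c) \<bullet> u \<and> (y - c) \<bullet> u \<le> R" if "y \<in> A u" for y
    proof -
      have "norm (y - c) \<le> R"
        using that AN frontier_subset R(2) by (force simp: dist_norm norm_minus_commute)
      moreover have "(y - c) \<bullet> u \<le> norm (y - c)" using norm_cauchy_schwarz[of "y - c" u] u by simp
      ultimately show ?thesis using that a by (auto simp: A_def)
    qed
    ultimately show ?thesis using cone_volume_le_cone_measure[OF u A] by (metis le_zero_eq)
  qed
  then have null: "K \<inter> proj -` A u \<in> null_sets lborel" if "u \<in> U" for u
    using that proj_vimage_measurable[OF A] by (auto simp: cone_volume_def null_sets_def)
  have "(\<Union>u\<in>U. K \<inter> proj -` A u) \<in> null_sets lborel"
    by (intro null_sets_UN' null) (auto simp: U_def countable_finite)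
  moreover have "K \<inter> proj -` N \<subseteq> (\<Union>u\<in>U. K \<inter> proj -` A u)"
  proof -
    have "\<exists>u\<in>U. y \<in> A u" if "y \<in> N" for y
    proof (rule ccontr)
      assume "\<not> (\<exists>u\<in>U. y \<in> A u)"
      then have not: "\<not> a \<le> (y - c) \<bullet> u" if "u \<in> U" for u using that \<open>y \<in> N\<close> by (auto simp: A_def)
      have "\<bar>(y - c) \<bullet> b\<bar> < a" if "b \<in> Basis" for b
        using not[of b] not[of "- b"] that by (auto simp: U_def)
      then have "(\<Sum>b\<in>Basis. \<bar>(y - c) \<bullet> b\<bar>) < (\<Sum>b\<in>(Basis::'a set). a)"
        by (intro sum_strict_mono) auto
      then have "norm (y - c) < r" using norm_le_l1[of "y - c"] by (simp add: a_def)
      then show False using frontier_norm_ge[of y] that N(2) by force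
    qed
    then show ?thesis by blast
  qed
  ultimately show ?thesis
    using proj_vimage_measurable[OF N(1)] unfolding cone_volume_def
    by (metis null_sets_subset null_setsD1 sets.Int K_measurable sets_lborel)
qed

section \<open>Regular boundary points\<close>

definition unit_normal :: "'a \<Rightarrow> 'a \<Rightarrow> bool" where
  "unit_normal v y \<longleftrightarrow> norm v = 1 \<and> (\<forall>z\<in>K. v \<bullet> z \<le> v \<bullet> y)"

definition regular_point :: "'a \<Rightarrow> bool" where
  "regular_point x \<longleftrightarrow> x \<in> frontier K \<and> (\<forall>H. supporting_hyperplane K x H \<longrightarrow> infdist c H = r)"

lemma unit_normal_normalize:
  assumes "w \<noteq> 0" "\<And>z. z \<in> K \<Longrightarrow> w \<bullet> z \<le> w \<bullet> y"
  shows "unit_normal (w /\<^sub>R norm w) y"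
proof -
  have "inverse (norm w) * (w \<bullet> z) \<le> inverse (norm w) * (w \<bullet> y)" if "z \<in> K" for z
    using assms(2)[OF that] by (rule mult_left_mono) simp
  then show ?thesis using assms(1) by (simp add: unit_normal_def)
qed

lemma unit_normal_exists:
  assumes "y \<in> frontier K"
  obtains v where "unit_normal v y"
proof -
  have "rel_interior K = interior K"
    using centre_in_interior by (intro rel_interior_nonempty_interior) auto
  then have "y \<in> K" "y \<notin> rel_interior K"
    using assms frontier_subset by (auto simp: frontier_def)
  show ?thesis
  proof (rule supporting_hyperplane_rel_boundary[OF convex \<open>y \<in> K\<close> \<open>y \<notin> rel_interior K\<close>])
    fix a assume a: "a \<noteq> 0" "\<And>z. z \<in> K \<Longrightarrow> a \<bullet> y \<le> a \<bullet> z"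
    \<comment> \<open>The supporting functional is minimal at \<open>y\<close>; the outer normal is
      its negative.\<close>
    have "unit_normal (- a /\<^sub>R norm (- a)) y"
      using a by (intro unit_normal_normalize) auto
    then show ?thesis by (rule that)
  qed
qed

text \<open>Test the support inequality at \<open>c + r *\<^sub>R v\<close>, the furthest point of
  the ball in direction \<open>v\<close>.\<close>

lemma unit_normal_ge:
  assumes "unit_normal v y"
  shows "r \<le> v \<bullet> (y - c)"
proof -
  have v: "norm v = 1" "v \<bullet> v = 1" using assms by (auto simp: unit_normal_def dot_square_norm)
  then have "c + r *\<^sub>R v \<in> K" using ball_subset r_pos by (auto simp: dist_norm)
  then have "v \<bullet> (c + r *\<^sub>R v) \<le> v \<bullet> y" using assms by (auto simp: unit_normal_def)
  then show ?thesis using v by (simp add: inner_simps)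
qed

text \<open>By Cauchy-Schwarz the supporting hyperplane has distance at least
  \<open>v \<bullet> (x - c)\<close> from \<open>c\<close>, and regularity makes this distance
  \<open>r\<close>; the inscribed ball gives the reverse inequality.\<close>

lemma regular_unit_normal:
  assumes x: "regular_point x" and v: "unit_normal v x"
  shows "v \<bullet> (x - c) = r"
proof (rule antisym)
  let ?H = "{y. v \<bullet> y = v \<bullet> x}"
  have "v \<noteq> 0" using v by (auto simp: unit_normal_def)
  then have "supporting_hyperplane K x ?H"
    unfolding supporting_hyperplane_def using v
    by (intro conjI exI[of _ v] exI[of _ "v \<bullet> x"]) (auto simp: unit_normal_def)
  then have "infdist c ?H = r" using x by (auto simp: regular_point_def)
  moreover have "v \<bullet> (x - c) \<le> infdist c ?H"
    unfolding infdist_notempty[OF ex_in_conv[THEN iffD1], OF exI[of _ x], of ?H, simplified]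
  proof (rule cINF_greatest)
    fix y assume "y \<in> ?H"
    then have "v \<bullet> (x - c) = v \<bullet> (y - c)" by (simp add: inner_simps)
    also have "\<dots> \<le> norm v * norm (y - c)" by (rule norm_cauchy_schwarz)
    finally show "v \<bullet> (x - c) \<le> dist c y"
      using v by (simp add: unit_normal_def dist_norm norm_minus_commute)
  qed auto
  ultimately show "v \<bullet> (x - c) \<le> r" by simp
qed (rule unit_normal_ge[OF v])

text \<open>
  The hyperplane with normal \<open>u + v\<close> also supports \<open>K\<close> at \<open>x\<close>, at distance \<open>2 * r / norm (u + v)\<close>.
\<close>

lemma regular_unit_normal_unique:
  assumes x: "regular_point x" and u: "unit_normal u x" and v: "unit_normal v x"
  shows "u = v"
proof -
  let ?w = "u + v"
  have eqs: "u \<bullet> (x - c) = r" "v \<bullet> (x - c) = r"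
    using regular_unit_normal[OF x] u v by auto
  then have w: "?w \<bullet> (x - c) = 2 * r" by (simp add: inner_simps)
  then have "?w \<noteq> 0" using r_pos by (metis inner_zero_left mult_eq_0_iff less_irrefl zero_neq_numeral)
  moreover have "?w \<bullet> z \<le> ?w \<bullet> x" if "z \<in> K" for z
    using u v that by (auto simp: unit_normal_def inner_add_left intro: add_mono)
  ultimately have "unit_normal (?w /\<^sub>R norm ?w) x"
    by (rule unit_normal_normalize)
  from regular_unit_normal[OF x this] have "2 * r / norm ?w = r"
    using w by (simp add: divide_inverse mult.commute)
  \<comment> \<open>Equality in the triangle inequality for two unit vectors forces them to
    coincide.\<close>
  then have "norm ?w = 2" using r_pos \<open>?w \<noteq> 0\<close> by (simp add: field_simps)
  then have "?w \<bullet> ?w = 4" by (simp add: dot_square_norm)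
  moreover have "u \<bullet> u = 1" "v \<bullet> v = 1" using u v by (auto simp: unit_normal_def dot_square_norm)
  ultimately have "(u - v) \<bullet> (u - v) = 0" by (simp add: inner_simps inner_commute)
  then show ?thesis by simp
qed

text \<open>Otherwise normals at points converging to \<open>x\<close> stay away from
  \<open>u\<close>. A subsequence converges by compactness of the sphere, its limit is again a
  normal at \<open>x\<close>, and uniqueness makes it \<open>u\<close>.\<close>

lemma unit_normals_near_regular_point:
  assumes x: "regular_point x" and u: "unit_normal u x" and \<eta>: "0 < \<eta>"
  obtains \<delta> where "0 < \<delta>"
    "\<And>y v. dist y x < \<delta> \<Longrightarrow> unit_normal v y \<Longrightarrow> dist v u < \<eta>"
proof (rule ccontr)
  assume "\<not> thesis"
  then have "\<not> (\<forall>y v. dist y x < 1 / Suc n \<longrightarrow> unit_normal v y \<longrightarrow> dist v u < \<eta>)" for n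
    using that[of "1 / Suc n"] by auto
  then obtain y v where yv: "\<And>n. dist (y n) x < 1 / Suc n" "\<And>n. unit_normal (v n) (y n)"
      "\<And>n. \<not> dist (v n) u < \<eta>"
    by metis
  have "v n \<in> sphere 0 1" for n using yv(2)[of n] by (simp add: unit_normal_def)
  moreover have "compact (sphere (0::'a) 1)" by (rule compact_sphere)
  ultimately obtain w s where w: "w \<in> sphere 0 1" "strict_mono s" "(v \<circ> s) \<longlonglongrightarrow> w"
    by (metis compact_def)
  have "(\<lambda>n. dist (y n) x) \<longlonglongrightarrow> 0"
  proof (rule tendsto_sandwich[OF _ _ tendsto_const])
    show "(\<lambda>n. 1 / real (Suc n)) \<longlonglongrightarrow> 0" by (rule LIMSEQ_Suc[OF lim_1_over_n])
    show "\<forall>\<^sub>F n in sequentially. dist (y n) x \<le> 1 / real (Suc n)"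
      using yv(1) by (intro always_eventually allI less_imp_le) auto
  qed auto
  then have "y \<longlonglongrightarrow> x" by (rule tendsto_dist_iff[THEN iffD2])
  then have ys: "(y \<circ> s) \<longlonglongrightarrow> x" using w(2) by (rule LIMSEQ_subseq_LIMSEQ)
  have "w \<bullet> z \<le> w \<bullet> x" if "z \<in> K" for z
  proof (rule LIMSEQ_le)
    show "(\<lambda>n. (v \<circ> s) n \<bullet> z) \<longlonglongrightarrow> w \<bullet> z" by (intro tendsto_inner w tendsto_const)
    show "(\<lambda>n. (v \<circ> s) n \<bullet> (y \<circ> s) n) \<longlonglongrightarrow> w \<bullet> x" by (intro tendsto_inner w ys)
    show "\<exists>N. \<forall>n\<ge>N. (v \<circ> s) n \<bullet> z \<le> (v \<circ> s) n \<bullet> (y \<circ> s) n"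
      using yv(2) that by (auto simp: unit_normal_def)
  qed
  then have "unit_normal w x" using w(1) by (simp add: unit_normal_def)
  then have "w = u" by (rule regular_unit_normal_unique[OF x _ u])
  then have "(\<lambda>n. dist ((v \<circ> s) n) u) \<longlonglongrightarrow> 0" using w(3) tendsto_dist_iff[of "v \<circ> s" u] by simp
  from LIMSEQ_le_const[OF this] have "\<eta> \<le> 0" using yv(3) by (auto simp: not_less)
  then show False using \<eta> by simp
qed

text \<open>A normal \<open>v\<close> at \<open>y\<close> gives
  \<open>(z - y) \<bullet> v \<le> 0\<close>, so \<open>(z - y) \<bullet> u\<close> is at most
  \<open>(z - y) \<bullet> (u - v)\<close>, where \<open>u - v\<close> is small. Exchanging
  \<open>y\<close> and \<open>z\<close> bounds the absolute value.\<close>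

lemma flat_near_regular_point:
  assumes x: "regular_point x" and u: "unit_normal u x" and \<eta>: "0 < \<eta>"
  obtains \<delta> where "0 < \<delta>"
    "\<And>y z. y \<in> frontier K \<Longrightarrow> z \<in> frontier K \<Longrightarrow> dist y x < \<delta> \<Longrightarrow> dist z x < \<delta> \<Longrightarrow>
      \<bar>(z - y) \<bullet> u\<bar> \<le> \<eta> * dist y z"
proof -
  obtain \<delta> where \<delta>: "0 < \<delta>" "\<And>y v. dist y x < \<delta> \<Longrightarrow> unit_normal v y \<Longrightarrow> dist v u < \<eta>"
    using unit_normals_near_regular_point[OF assms] by blast
  have le: "(z - y) \<bullet> u \<le> \<eta> * dist y z" if yz: "y \<in> frontier K" "z \<in> frontier K" "dist y x < \<delta>" for y z
  proof -
    obtain v where v: "unit_normal v y" using unit_normal_exists[OF yz(1)] .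
    have "z \<in> K" using yz frontier_subset by auto
    then have "(z - y) \<bullet> v \<le> 0"
      using v by (simp add: unit_normal_def inner_diff_right inner_commute[of _ v])
    then have "(z - y) \<bullet> u \<le> (z - y) \<bullet> (u - v)" by (simp add: inner_diff_right)
    also have "\<dots> \<le> norm (z - y) * norm (u - v)" by (rule norm_cauchy_schwarz)
    also have "\<dots> \<le> dist y z * \<eta>"
      using \<delta>(2)[OF yz(3) v] by (intro mult_mono) (auto simp: dist_norm norm_minus_commute)
    finally show ?thesis by (simp add: mult.commute)
  qed
  show ?thesis
  proof (rule that[OF \<delta>(1)])
    fix y z assume yz: "y \<in> frontier K" "z \<in> frontier K" "dist y x < \<delta>" "dist z x < \<delta>"
    have "- ((z - y) \<bullet> u) = (y - z) \<bullet> u" by (simp add: inner_diff_left)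
    then show "\<bar>(z - y) \<bullet> u\<bar> \<le> \<eta> * dist y z"
      using le[OF yz(1,2,3)] le[OF yz(2,1,4)] by (auto simp: abs_le_iff dist_commute)
  qed
qed

lemma central_projection_near_regular_point:
  assumes x: "regular_point x" and u: "unit_normal u x" and q: "1 < q"
  obtains \<delta> where "0 < \<delta>"
    "\<And>y. y \<in> frontier K \<Longrightarrow> dist y x < \<delta> \<Longrightarrow> r / q \<le> (y - c) \<bullet> u \<and> (y - c) \<bullet> u \<le> r"
    "\<And>y z. y \<in> frontier K \<Longrightarrow> z \<in> frontier K \<Longrightarrow> dist y x < \<delta> \<Longrightarrow> dist z x < \<delta> \<Longrightarrow>
      dist (central_projection r u (y - c)) (central_projection r u (z - c)) \<le> q * dist y z \<and>
      dist y z \<le> q * dist (central_projection r u (y - c)) (central_projection r u (z - c))"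
proof -
  obtain R where R: "0 < R" "K \<subseteq> cball c R" using subset_cball .
  \<comment> \<open>Chosen so that the upper constant \<open>r / a * (1 + \<theta>)\<close> is
    exactly \<open>q\<close> and the lower one, \<open>1 - \<theta>\<close>, is at least
    \<open>1 / q\<close>; \<open>\<eta>\<close> is the slope that yields
    \<open>\<theta>\<close>.\<close>
  define a where "a = 2 * r / (1 + q)"
  define \<theta> where "\<theta> = (q - 1) / (q + 1)"
  define \<eta> where "\<eta> = \<theta> * a / R"
  have a: "0 < a" "a < r" "r / q \<le> a" using r_pos q by (auto simp: a_def field_simps)
  have \<theta>: "0 < \<theta>" "r / a * (1 + \<theta>) = q" "1 / q \<le> 1 - \<theta>"
  proof -
    have "1 + \<theta> = 2 * q / (1 + q)" using q by (simp add: \<theta>_def field_simps)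
    then show "r / a * (1 + \<theta>) = q" using r_pos q by (simp add: a_def)
  qed (use q in \<open>auto simp: \<theta>_def field_simps\<close>)
  have \<eta>: "0 < \<eta>" "\<eta> * R / a = \<theta>" using \<theta> a R by (auto simp: \<eta>_def)
  obtain \<delta> where \<delta>: "0 < \<delta>" "\<And>y z. y \<in> frontier K \<Longrightarrow> z \<in> frontier K \<Longrightarrow> dist y x < \<delta> \<Longrightarrow> dist z x < \<delta> \<Longrightarrow>
      \<bar>(z - y) \<bullet> u\<bar> \<le> \<eta> * dist y z"
    using flat_near_regular_point[OF x u \<eta>(1)] by blast
  have nu: "norm u = 1" using u by (simp add: unit_normal_def)
  have xu: "(x - c) \<bullet> u = r" using regular_unit_normal[OF x u] by (simp add: inner_commute)
  \<comment> \<open>The height in direction \<open>u\<close> is \<open>r\<close> at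
    \<open>x\<close>, is maximal over \<open>K\<close> there, and changes by at most the distance
    moved.\<close>
  have bounds: "a \<le> (y - c) \<bullet> u \<and> (y - c) \<bullet> u \<le> r" if "y \<in> frontier K" "dist y x < r - a" for y
  proof -
    have "(x - y) \<bullet> u \<le> norm (x - y)" using norm_cauchy_schwarz[of "x - y" u] nu by simp
    then have "(x - c) \<bullet> u - (y - c) \<bullet> u < r - a"
      using that by (simp add: dist_norm norm_minus_commute inner_diff_left)
    moreover have "y \<in> K" using that frontier_subset by auto
    then have "(y - c) \<bullet> u \<le> (x - c) \<bullet> u"
      using u by (simp add: unit_normal_def inner_diff_right inner_commute[of _ u])
    ultimately show ?thesis using xu by linarith
  qed
  show ?thesis
  proof (rule that[of "min \<delta> (r - a)"])
    show "0 < min \<delta> (r - a)" using \<delta> a by simp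
    show "r / q \<le> (y - c) \<bullet> u \<and> (y - c) \<bullet> u \<le> r" if "y \<in> frontier K" "dist y x < min \<delta> (r - a)" for y
      using bounds[of y] that a by auto
    fix y z assume yz: "y \<in> frontier K" "z \<in> frontier K" "dist y x < min \<delta> (r - a)" "dist z x < min \<delta> (r - a)"
    have flat: "\<bar>((z - c) - (y - c)) \<bullet> u\<bar> \<le> \<eta> * dist (y - c) (z - c)"
      using \<delta>(2)[OF yz(1,2)] yz(3,4) by (simp add: dist_norm)
    have zR: "norm (z - c) \<le> R"
      using yz frontier_subset R(2) by (force simp: dist_norm norm_minus_commute)
    have near: "a \<le> (y - c) \<bullet> u" "a \<le> (z - c) \<bullet> u" "(y - c) \<bullet> u \<le> r"
      using bounds yz by auto
    let ?d = "dist (central_projection r u (y - c)) (central_projection r u (z - c))"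
    have "?d \<le> q * dist y z"
      using central_projection_bilipschitz(1)[OF a(1) near(1,2) r_pos zR _ flat,
          unfolded \<eta>(2) \<theta>(2)] \<eta>(1)
      by (simp add: dist_norm)
    moreover have "(1 - \<theta>) * dist y z \<le> ?d"
      using central_projection_bilipschitz(2)[OF a(1) near(1,2) r_pos zR _ flat near(3)] \<eta>
      by (simp add: dist_norm)
    then have "1 / q * dist y z \<le> ?d"
      using mult_right_mono[OF \<theta>(3), of "dist y z"] by simp
    then have "dist y z \<le> q * ?d" using q by (simp add: field_simps)
    ultimately show "?d \<le> q * dist y z \<and> dist y z \<le> q * ?d" by blast
  qed
qed

end

section \<open>Surface measure and cone volume\<close>

lemma ennreal_le_inverse_mult:
  assumes "0 < s" "ennreal s * X \<le> Y"
  shows "X \<le> ennreal (1 / s) * Y"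
proof -
  have "X = ennreal (1 / s) * (ennreal s * X)"
    using assms(1) by (simp add: mult.assoc[symmetric] ennreal_mult[symmetric])
  also have "\<dots> \<le> ennreal (1 / s) * Y" using assms(2) by (rule mult_left_mono) simp
  finally show ?thesis .
qed

lemma ennreal_le_of_power_factor:
  fixes X Y :: ennreal
  assumes "\<And>q::real. 1 < q \<Longrightarrow> X \<le> ennreal (q ^ k) * Y"
  shows "X \<le> Y"
proof (cases Y)
  case (real y)
  \<comment> \<open>A single factor shows that \<open>X\<close> is finite, so the limit
    \<open>q \<rightarrow> 1\<close> can be taken in the reals.\<close>
  have "X \<le> ennreal (2 ^ k) * Y" by (rule assms) simp
  also have "\<dots> < top" using real by (simp add: ennreal_mult_less_top)
  finally obtain x where x: "X = ennreal x" "0 \<le> x" by (cases X) auto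
  have "x \<le> y"
  proof (rule LIMSEQ_le_const)
    have "(\<lambda>n. 1 / real (Suc n)) \<longlonglongrightarrow> 0" by (rule LIMSEQ_Suc[OF lim_1_over_n])
    then have "(\<lambda>n. (1 + 1 / real (Suc n)) ^ k * y) \<longlonglongrightarrow> (1 + 0) ^ k * y" by (intro tendsto_intros)
    then show "(\<lambda>n. (1 + 1 / real (Suc n)) ^ k * y) \<longlonglongrightarrow> y" by simp
    have "x \<le> (1 + 1 / real (Suc n)) ^ k * y" for n
      using assms[of "1 + 1 / real (Suc n)"] x real by (simp add: ennreal_mult[symmetric])
    then show "\<exists>N. \<forall>n\<ge>N. x \<le> (1 + 1 / real (Suc n)) ^ k * y" by blast
  qed
  then show ?thesis using x real by (simp add: ennreal_leI)
qed simp

text \<open>Making the cover disjoint cuts \<open>A\<close> into pieces that each lie in one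
  \<open>V i\<close>, up to an \<open>M\<close>-null rest; the local estimates then add up.\<close>

lemma emeasure_le_by_local_comparison:
  fixes b C :: ennreal and V :: "nat \<Rightarrow> 'a set"
  assumes sets: "sets N = sets M" and V: "\<And>i. V i \<in> sets M" and A: "A \<in> sets M"
    and loc: "\<And>i B. B \<in> sets M \<Longrightarrow> B \<subseteq> A \<inter> V i \<Longrightarrow> emeasure M B * b \<le> C * emeasure N B"
    and null: "emeasure M (A - (\<Union>i. V i)) = 0"
  shows "emeasure M A * b \<le> C * emeasure N A"
proof -
  define B where "B i = A \<inter> disjointed V i" for i
  have range: "range (disjointed V) \<subseteq> sets M" using V by (intro sets.range_disjointed_sets) auto
  then have B: "B i \<in> sets M" for i using A unfolding B_def by blast
  have disj: "disjoint_family B"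
    unfolding B_def by (intro disjoint_family_on_bisimulation[OF disjoint_family_disjointed[of V]]) auto
  have union: "(\<Union>i. B i) = A \<inter> (\<Union>i. V i)"
    unfolding B_def UN_disjointed_eq[symmetric, of V] by blast
  have "emeasure M A \<le> emeasure M (\<Union>i. B i) + emeasure M (A - (\<Union>i. V i))"
    using A V B by (intro order_trans[OF emeasure_mono emeasure_subadditive]) (auto simp: union)
  also have "\<dots> = (\<Sum>i. emeasure M (B i))"
    using B disj by (simp add: null suminf_emeasure image_subset_iff)
  finally have "emeasure M A * b \<le> (\<Sum>i. emeasure M (B i) * b)"
    by (simp add: mult_right_mono)
  also have "\<dots> \<le> (\<Sum>i. C * emeasure N (B i))"
    using B disjointed_subset[of V] by (intro suminf_le loc) (auto simp: B_def)
  also have "\<dots> = C * emeasure N (\<Union>i. B i)"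
    using B disj sets by (simp add: suminf_emeasure image_subset_iff)
  also have "\<dots> \<le> C * emeasure N A"
    using A sets by (intro mult_left_mono emeasure_mono) (auto simp: union)
  finally show ?thesis .
qed

context body_with_ball
begin

text \<open>Pass through the slice of \<open>A\<close> in the supporting hyperplane, where
  proportionality is exact. The exponent \<open>k\<close> collects \<open>DIM('a) - 1\<close> from
  the Lipschitz bounds and \<open>DIM('a)\<close> from comparing cone volumes.\<close>

lemma surface_measure_cone_volume_local:
  fixes e :: 'a
  defines "\<alpha> \<equiv> emeasure surface_measure ({x. x \<bullet> e = 0} \<inter> cball 0 1)"
    and "\<beta> \<equiv> emeasure (cone_measure r e) (cball 0 1)"
    and "k \<equiv> DIM('a) - 1 + DIM('a)"
  assumes e: "norm e = 1" and x: "regular_point x" and q: "1 < q"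
    and fin: "emeasure surface_measure (frontier K) < \<infinity>"
  obtains V where "open V" "x \<in> V"
    "\<And>A. A \<in> sets borel \<Longrightarrow> A \<subseteq> frontier K \<inter> V \<Longrightarrow>
      emeasure surface_measure A * \<beta> \<le> ennreal (q ^ k) * (\<alpha> * cone_volume A)"
    "\<And>A. A \<in> sets borel \<Longrightarrow> A \<subseteq> frontier K \<inter> V \<Longrightarrow>
      \<alpha> * cone_volume A \<le> ennreal (q ^ k) * (emeasure surface_measure A * \<beta>)"
proof -
  obtain u where u: "unit_normal u x" using unit_normal_exists x by (auto simp: regular_point_def)
  then have nu: "norm u = 1" by (simp add: unit_normal_def)
  from central_projection_near_regular_point[OF x u q] obtain \<delta> where \<delta>: "0 < \<delta>"
    "\<And>y. y \<in> frontier K \<Longrightarrow> dist y x < \<delta> \<Longrightarrow> r / q \<le> (y - c) \<bullet> u \<and> (y - c) \<bullet> u \<le> r"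
    "\<And>y z. y \<in> frontier K \<Longrightarrow> z \<in> frontier K \<Longrightarrow> dist y x < \<delta> \<Longrightarrow> dist z x < \<delta> \<Longrightarrow>
      dist (central_projection r u (y - c)) (central_projection r u (z - c)) \<le> q * dist y z \<and>
      dist y z \<le> q * dist (central_projection r u (y - c)) (central_projection r u (z - c))" by metis
  have rq: "0 < r / q" using r_pos q by simp
  let ?n = "DIM('a) - 1"
  have main: "emeasure surface_measure A * \<beta> \<le> ennreal (q ^ k) * (\<alpha> * cone_volume A) \<and>
      \<alpha> * cone_volume A \<le> ennreal (q ^ k) * (emeasure surface_measure A * \<beta>)"
    if A: "A \<in> sets borel" "A \<subseteq> frontier K \<inter> ball x \<delta>" for A
  proof -
    have AK: "A \<subseteq> frontier K" and Ad: "\<And>y. y \<in> A \<Longrightarrow> dist y x < \<delta>"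
      using A by (auto simp: dist_commute)
    have Au: "r / q \<le> (y - c) \<bullet> u \<and> (y - c) \<bullet> u \<le> r" if "y \<in> A" for y
      using \<delta>(2) that AK Ad by blast
    then have Au0: "0 < (y - c) \<bullet> u" if "y \<in> A" for y using that rq by (meson less_le_trans)
    have lip: "dist (central_projection r u (y - c)) (central_projection r u (z - c)) \<le> q * dist y z"
      "dist y z \<le> q * dist (central_projection r u (y - c)) (central_projection r u (z - c))"
      if "y \<in> A" "z \<in> A" for y z
      using \<delta>(3)[of y z] that AK Ad by blast+
    let ?B = "slice r u A"
    have B: "?B \<in> sets borel" "?B \<subseteq> {w. w \<bullet> u = 0}"
      using A(1) by (auto simp: slice_def)
    define h where "h = emeasure surface_measure ?B"
    define m where "m = emeasure (cone_measure r u) ?B"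
    have q0: "0 < q" using q by simp
    have h1: "h \<le> ennreal (q ^ ?n) * emeasure surface_measure A"
      unfolding h_def by (rule emeasure_slice_le[OF nu r_pos q0 A(1) AK Au0 lip(1)])
    have h2: "emeasure surface_measure A \<le> ennreal (q ^ ?n) * h"
      unfolding h_def by (rule emeasure_le_slice[OF nu r_pos q0 A(1) AK Au0 lip(2)])
    have m1: "cone_volume A \<le> m"
      unfolding m_def using Au Au0 by (intro cone_volume_le_cone_measure[OF nu A(1)]) blast
    \<comment> \<open>Heights on \<open>A\<close> are at least \<open>r / q\<close>, so the dilation
      factor is \<open>1 / q\<close>.\<close>
    have "ennreal ((r / q / r) ^ DIM('a)) * m \<le> cone_volume A"
      unfolding m_def using Au by (intro cone_measure_le_cone_volume[OF nu A(1) rq r_pos]) blast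
    from ennreal_le_inverse_mult[OF _ this] have m2: "m \<le> ennreal (q ^ DIM('a)) * cone_volume A"
      using r_pos q by (simp add: power_divide)
    have hm: "h * \<beta> = m * \<alpha>"
      unfolding h_def m_def \<alpha>_def \<beta>_def emeasure_surface_measure_disc_unit[OF e nu]
        emeasure_cone_measure_cball_unit[OF e nu]
      by (rule surface_measure_hyperplane[OF nu r_pos emeasure_disc_finite[OF nu fin] B])
    have qk: "ennreal (q ^ k) = ennreal (q ^ ?n) * ennreal (q ^ DIM('a))"
      unfolding k_def power_add using q by (intro ennreal_mult) simp_all
    have "emeasure surface_measure A * \<beta> \<le> ennreal (q ^ ?n) * h * \<beta>"
      using h2 by (rule mult_right_mono) simp
    also have "\<dots> = ennreal (q ^ ?n) * (h * \<beta>)" by (rule mult.assoc)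
    also have "\<dots> = ennreal (q ^ ?n) * \<alpha> * m" unfolding hm by (simp only: mult_ac)
    also have "\<dots> \<le> ennreal (q ^ ?n) * \<alpha> * (ennreal (q ^ DIM('a)) * cone_volume A)"
      using m2 by (rule mult_left_mono) simp
    also have "\<dots> = ennreal (q ^ k) * (\<alpha> * cone_volume A)"
      unfolding qk by (simp only: mult_ac)
    finally have 1: "emeasure surface_measure A * \<beta> \<le> ennreal (q ^ k) * (\<alpha> * cone_volume A)" .
    have "\<alpha> * cone_volume A \<le> \<alpha> * m" using m1 by (rule mult_left_mono) simp
    also have "\<dots> = h * \<beta>" using hm by (simp add: mult.commute)
    also have "\<dots> \<le> ennreal (q ^ ?n) * emeasure surface_measure A * \<beta>"
      using h1 by (rule mult_right_mono) simp
    \<comment> \<open>This direction costs only \<open>q ^ ?n\<close>, enlarged to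
      \<open>q ^ k\<close> so that both bounds have the same form.\<close>
    also have "\<dots> \<le> ennreal (q ^ k) * emeasure surface_measure A * \<beta>"
      using q by (intro mult_right_mono ennreal_leI power_increasing) (auto simp: k_def)
    finally show ?thesis using 1 by (simp add: mult.assoc)
  qed
  show ?thesis
    by (rule that[of "ball x \<delta>"]) (use main \<delta>(1) in auto)
qed

lemma surface_measure_eq_cone_volume:
  fixes e :: 'a
  defines "\<alpha> \<equiv> emeasure surface_measure ({x. x \<bullet> e = 0} \<inter> cball 0 1)"
    and "\<beta> \<equiv> emeasure (cone_measure r e) (cball 0 1)"
  assumes e: "norm e = 1"
    and regular: "AE x in surface_measure. x \<in> frontier K \<longrightarrow> regular_point x"
    and fin: "emeasure surface_measure (frontier K) < \<infinity>"
    and pos: "emeasure surface_measure (frontier K) \<noteq> 0"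
  shows "\<alpha> \<noteq> 0"
    and "A \<in> sets borel \<Longrightarrow> A \<subseteq> frontier K \<Longrightarrow> emeasure surface_measure A * \<beta> = \<alpha> * cone_volume A"
proof -
  define k where "k = DIM('a) - 1 + DIM('a)"
  \<comment> \<open>Presents \<open>cone_volume\<close> as a measure, as the comparison lemma
    requires.\<close>
  define \<nu> where "\<nu> = distr (density lborel (indicator K)) borel proj"
  have \<nu>: "emeasure \<nu> A = cone_volume A" if "A \<in> sets borel" for A
    using proj_vimage_measurable[OF that] that unfolding \<nu>_def cone_volume_def
    by (simp add: emeasure_distr emeasure_density nn_integral_indicator indicator_inter_arith[symmetric])
  have [simp]: "sets \<nu> = sets borel" by (simp add: \<nu>_def)
  have \<beta>: "\<beta> \<noteq> 0"
    unfolding \<beta>_def using emeasure_cone_measure_cball_pos[OF e r_pos] .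
  obtain N where N: "N \<in> null_sets surface_measure" "{x. \<not> (x \<in> frontier K \<longrightarrow> regular_point x)} \<subseteq> N"
    using regular by (auto simp: eventually_ae_filter)
  have "\<exists>V. open V \<and> x \<in> V \<and> (\<forall>A. A \<in> sets borel \<longrightarrow> A \<subseteq> frontier K \<inter> V \<longrightarrow>
      emeasure surface_measure A * \<beta> \<le> ennreal (q ^ k) * (\<alpha> * cone_volume A) \<and>
      \<alpha> * cone_volume A \<le> ennreal (q ^ k) * (emeasure surface_measure A * \<beta>))"
    if "1 < q" "regular_point x" for q x
    using surface_measure_cone_volume_local[OF e that(2,1) fin] unfolding \<alpha>_def \<beta>_def k_def by metis
  then obtain W where W: "\<And>q x. 1 < q \<Longrightarrow> regular_point x \<Longrightarrow> open (W q x) \<and> x \<in> W q x"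
    "\<And>q x A. 1 < q \<Longrightarrow> regular_point x \<Longrightarrow> A \<in> sets borel \<Longrightarrow> A \<subseteq> frontier K \<inter> W q x \<Longrightarrow>
      emeasure surface_measure A * \<beta> \<le> ennreal (q ^ k) * (\<alpha> * cone_volume A) \<and>
      \<alpha> * cone_volume A \<le> ennreal (q ^ k) * (emeasure surface_measure A * \<beta>)"
    by metis
  have "\<exists>V::nat \<Rightarrow> 'a set. (\<forall>i. open (V i)) \<and> frontier K - (\<Union>i. V i) \<subseteq> N \<and>
      (\<forall>i A. A \<in> sets borel \<longrightarrow> A \<subseteq> frontier K \<inter> V i \<longrightarrow>
        emeasure surface_measure A * \<beta> \<le> ennreal (q ^ k) * (\<alpha> * cone_volume A) \<and>
        \<alpha> * cone_volume A \<le> ennreal (q ^ k) * (emeasure surface_measure A * \<beta>))"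
    if q: "1 < q" for q
  proof -
    let ?F = "insert {} (W q ` {x. regular_point x})"
    have "\<And>S. S \<in> ?F \<Longrightarrow> open S" using W(1)[OF q] by auto
    from Lindelof[OF this] obtain F where F: "F \<subseteq> ?F" "countable F" "\<Union>F = \<Union>?F" by blast
    \<comment> \<open>Adding the empty set keeps the family non-empty, so that it can be enumerated,
      and leaves the union unchanged.\<close>
    define V where "V = from_nat_into (insert {} F)"
    have range: "range V = insert {} F" unfolding V_def using F(2) by (intro range_from_nat_into) auto
    then have VF: "V i \<in> ?F" for i using F(1) by blast
    have "open (V i)" for i using VF[of i] W(1)[OF q] by auto
    moreover have "frontier K - (\<Union>i. V i) \<subseteq> N"
    proof
      fix x assume x: "x \<in> frontier K - (\<Union>i. V i)"
      have "(\<Union>i. V i) = \<Union>?F" using range F(3) by auto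
      then have "\<not> regular_point x" using x W(1)[OF q, of x] by auto
      then show "x \<in> N" using x N(2) by auto
    qed
    moreover have "emeasure surface_measure A * \<beta> \<le> ennreal (q ^ k) * (\<alpha> * cone_volume A) \<and>
        \<alpha> * cone_volume A \<le> ennreal (q ^ k) * (emeasure surface_measure A * \<beta>)"
      if "A \<in> sets borel" "A \<subseteq> frontier K \<inter> V i" for i A
    proof (cases "V i = {}")
      case True
      then show ?thesis using that by (simp add: cone_volume_def)
    next
      case False
      then show ?thesis using VF[of i] W(2)[OF q _ that(1)] that(2) by blast
    qed
    ultimately show ?thesis by blast
  qed
  then obtain V :: "real \<Rightarrow> nat \<Rightarrow> 'a set" where V: "\<And>q i. 1 < q \<Longrightarrow> open (V q i)"
    "\<And>q. 1 < q \<Longrightarrow> frontier K - (\<Union>i. V q i) \<subseteq> N"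
    "\<And>q i A. 1 < q \<Longrightarrow> A \<in> sets borel \<Longrightarrow> A \<subseteq> frontier K \<inter> V q i \<Longrightarrow>
        emeasure surface_measure A * \<beta> \<le> ennreal (q ^ k) * (\<alpha> * cone_volume A) \<and>
        \<alpha> * cone_volume A \<le> ennreal (q ^ k) * (emeasure surface_measure A * \<beta>)"
    by metis
  have Vb: "V q i \<in> sets borel" if "1 < q" for q i using V(1)[OF that] by simp
  have null: "emeasure surface_measure (A - (\<Union>i. V q i)) = 0"
    if "1 < q" "A \<in> sets borel" "A \<subseteq> frontier K" for A q
  proof -
    have "A - (\<Union>i. V q i) \<subseteq> N" using V(2)[OF that(1)] that(3) by blast
    moreover have "A - (\<Union>i. V q i) \<in> sets surface_measure" using that Vb by auto
    ultimately show ?thesis using N(1) by (metis null_sets_subset null_setsD1)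
  qed
  have le: "emeasure surface_measure A * \<beta> \<le> \<alpha> * cone_volume A"
    if A: "A \<in> sets borel" "A \<subseteq> frontier K" for A
  proof (rule ennreal_le_of_power_factor)
    fix q :: real assume q: "1 < q"
    have "emeasure surface_measure A * \<beta> \<le> ennreal (q ^ k) * \<alpha> * emeasure \<nu> A"
    proof (rule emeasure_le_by_local_comparison[where V = "V q"])
      fix i B assume B: "B \<in> sets surface_measure" "B \<subseteq> A \<inter> V q i"
      then have "B \<in> sets borel" "B \<subseteq> frontier K \<inter> V q i" using A by auto
      from V(3)[OF q this] show "emeasure surface_measure B * \<beta> \<le> ennreal (q ^ k) * \<alpha> * emeasure \<nu> B"
        using B by (simp add: \<nu> mult.assoc)
    qed (use A q Vb null in auto)
    then show "emeasure surface_measure A * \<beta> \<le> ennreal (q ^ k) * (\<alpha> * cone_volume A)"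
      using A by (simp add: \<nu> mult.assoc)
  qed
  \<comment> \<open>This comes before \<open>ge\<close>, which uses it:
    \<open>cone_volume_null\<close> asks for discs of positive surface measure.\<close>
  show \<alpha>: "\<alpha> \<noteq> 0" using le[of "frontier K"] pos \<beta> by auto
  have ge: "\<alpha> * cone_volume A \<le> emeasure surface_measure A * \<beta>"
    if A: "A \<in> sets borel" "A \<subseteq> frontier K" for A
  proof (rule ennreal_le_of_power_factor)
    fix q :: real assume q: "1 < q"
    have "emeasure \<nu> A * \<alpha> \<le> ennreal (q ^ k) * \<beta> * emeasure surface_measure A"
    proof (rule emeasure_le_by_local_comparison[where V = "V q"])
      fix i B assume B: "B \<in> sets \<nu>" "B \<subseteq> A \<inter> V q i"
      then have "B \<in> sets borel" "B \<subseteq> frontier K \<inter> V q i" using A by auto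
      from V(3)[OF q this] show "emeasure \<nu> B * \<alpha> \<le> ennreal (q ^ k) * \<beta> * emeasure surface_measure B"
        using B by (simp add: \<nu> mult_ac)
    next
      have "cone_volume (A - (\<Union>i. V q i)) = 0"
      proof (rule cone_volume_null[OF _ _ null[OF q A] fin])
        show "emeasure surface_measure ({x. x \<bullet> u = 0} \<inter> cball 0 1) \<noteq> 0" if "norm u = 1" for u :: 'a
          using \<alpha> emeasure_surface_measure_disc_unit[OF e that] by (simp add: \<alpha>_def)
      qed (use A Vb[OF q] in auto)
      then show "emeasure \<nu> (A - (\<Union>i. V q i)) = 0" using A Vb[OF q] by (subst \<nu>) auto
    qed (use A q Vb in auto)
    then show "\<alpha> * cone_volume A \<le> ennreal (q ^ k) * (emeasure surface_measure A * \<beta>)"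
      using A by (simp add: \<nu> mult_ac)
  qed
  show "emeasure surface_measure A * \<beta> = \<alpha> * cone_volume A" if "A \<in> sets borel" "A \<subseteq> frontier K"
    using le[OF that] ge[OF that] by (rule antisym)
qed

section \<open>From proportional measures to equal distributions\<close>

lemma cone_volume_frontier:
  assumes "A \<in> sets borel"
  shows "cone_volume (frontier K \<inter> A) = cone_volume A"
  unfolding cone_volume_def
proof (rule emeasure_eq_AE)
  have "AE z in lborel. z \<noteq> c" by (rule AE_lborel_singleton)
  then show "AE z in lborel. z \<in> K \<inter> proj -` (frontier K \<inter> A) \<longleftrightarrow> z \<in> K \<inter> proj -` A"
  proof eventually_elim
    case (elim z)
    then have "proj z \<in> frontier K" by (rule projE)
    then show ?case by auto
  qed
qed (use assms proj_vimage_measurable in auto)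

lemma emeasure_projective_distribution:
  assumes "A \<in> sets borel"
  shows "emeasure (projective_distribution K c) A = cone_volume (frontier K \<inter> A) / cone_volume (frontier K)"
proof -
  have "cone_volume (frontier K) = emeasure lborel K"
    using cone_volume_frontier[of UNIV] by (simp add: cone_volume_def)
  then show ?thesis
    unfolding cone_volume_frontier[OF assms] using proj_vimage_measurable[OF assms] assms
    by (simp add: projective_distribution_def emeasure_distr cone_volume_def)
qed

end

theorem proposition1:
  fixes K :: "'a::euclidean_space set" and c :: 'a and r :: real
    and M :: "'m measure" and Y\<^sub>c :: "'m \<Rightarrow> 'a"
    and N :: "'n measure" and Y :: "'n \<Rightarrow> 'a"
  assumes "convex_body K" and "inscribed_sphere K c r"
    and "prob_space M" and "Y\<^sub>c \<in> borel_measurable M"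
    and "distr M borel Y\<^sub>c = projective_distribution K c"
    and "prob_space N" and "Y \<in> borel_measurable N"
    and "distr N borel Y = uniform_boundary_distribution K"
  shows "distr M borel Y\<^sub>c = distr N borel Y"
proof -
  interpret body_with_ball K c r
    using assms(1,2) by unfold_locales (auto simp: inscribed_sphere_def)
  let ?S = "frontier K"
  interpret Y: prob_space "distr N borel Y"
    using assms(6,7) by (intro prob_space.prob_space_distr) auto
  have "emeasure surface_measure ?S / emeasure surface_measure ?S = 1"
    using Y.emeasure_space_1 unfolding assms(8) uniform_boundary_distribution_def
    by (simp add: emeasure_uniform_measure)
  \<comment> \<open>In \<open>ennreal\<close> both \<open>0 / 0\<close> and
    \<open>\<infinity> / \<infinity>\<close> are \<open>0\<close>, so quotient \<open>1\<close>
    excludes these two values.\<close>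
  then have S: "emeasure surface_measure ?S \<noteq> 0" "emeasure surface_measure ?S < \<infinity>"
    by (auto simp: divide_eq_1_ennreal less_top)
  obtain e :: 'a where e: "norm e = 1" using nonempty_Basis norm_Basis by blast
  define \<alpha> where "\<alpha> = emeasure surface_measure ({x. x \<bullet> e = 0} \<inter> cball 0 1)"
  define \<beta> where "\<beta> = emeasure (cone_measure r e) (cball 0 1)"
  have regular: "AE x in surface_measure. x \<in> ?S \<longrightarrow> regular_point x"
    using assms(2) by (auto simp: inscribed_sphere_def regular_point_def)
  note proportional = surface_measure_eq_cone_volume[OF e regular S(2,1), folded \<alpha>_def \<beta>_def]
  have \<alpha>: "\<alpha> \<noteq> 0" "\<alpha> \<noteq> \<infinity>"
    using proportional(1) emeasure_disc_finite[OF e S(2), of 1] by (auto simp: \<alpha>_def)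
  have \<beta>: "\<beta> \<noteq> 0" "\<beta> \<noteq> \<infinity>"
    using emeasure_cone_measure_cball_pos[OF e r_pos] emeasure_cone_measure_cball_finite[OF e r_pos, of 1]
    by (auto simp: \<beta>_def)
  show ?thesis
  proof (rule measure_eqI)
    fix A assume "A \<in> sets (distr M borel Y\<^sub>c)"
    then have A: "A \<in> sets borel" by simp
    have "emeasure (distr M borel Y\<^sub>c) A = cone_volume (?S \<inter> A) / cone_volume ?S"
      unfolding assms(5) by (rule emeasure_projective_distribution[OF A])
    \<comment> \<open>Expand by \<open>\<alpha>\<close>, exchange by proportionality, then cancel
      \<open>\<beta>\<close>; both constants are nonzero and finite.\<close>
    also have "\<dots> = (\<alpha> * cone_volume (?S \<inter> A)) / (\<alpha> * cone_volume ?S)"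
      using \<alpha> by (simp add: divide_mult_eq mult.commute[of \<alpha>])
    also have "\<dots> = (emeasure surface_measure (?S \<inter> A) * \<beta>) / (emeasure surface_measure ?S * \<beta>)"
      using A by (simp add: proportional(2))
    also have "\<dots> = emeasure surface_measure (?S \<inter> A) / emeasure surface_measure ?S"
      using \<beta> by (rule divide_mult_eq)
    also have "\<dots> = emeasure (distr N borel Y) A"
      unfolding assms(8) uniform_boundary_distribution_def using A by simp
    finally show "emeasure (distr M borel Y\<^sub>c) A = emeasure (distr N borel Y) A" .
  qed simp
qed

end
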